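(* Let $k\ge1$ be an integer, $\gamma\in(0,1)$, $\rho=k+\gamma$. Let $\theta\in\Theta_\rho(L_\gamma)$ and $\varphi_\epsilon=\epsilon^{\alpha/\rho}$. Suppose conditions $(A_1)$, $(A_2)$ and $(A_3)$ hold, and let $\tilde\theta(t)$ be the associated estimator (see context). Then, for any interval $[c,d]\subset[0,T]$, $$\limsup_{\epsilon\to0}\ \sup_{\theta(\cdot)\in\Theta_\rho(L_\gamma)}\ \sup_{c\le t\le d}E|\tilde\theta(t)-\theta(t)|\,\epsilon^{-\frac{\rho+1-\alpha}{\rho}}<\infty .$$
   Context: **Noise.** A random variable $Z$ has the stable law $S_\alpha(\sigma,\beta,\mu)$ (with $\alpha\neq 1$, $\alpha\in(0,2]$, $\sigma>0$, $\beta\in[-1,1]$, $\mu\in\mathbb{R}$) if $E[e^{iuZ}]=\exp\{-\sigma^\alpha|u|^\alpha(1-i\beta\,\mathrm{sgn}(u)\tan(\alpha\pi/2))+i\mu u\}$. Throughout $1<\alpha<2$ and $\beta\in[-1,1]$ are fixed. On a probability space $(\Omega,\mathcal{F},P)$ with a right-continuous increasing family of $\sigma$-algebras $\{\mathcal{F}_t\}$, $Z=\{Z_t,t\ge0\}$ is a standard $\alpha$-stable Lévy process: adapted (càdlàg), $Z_0=0$ a.s., with independent increments, and $Z_t-Z_s\sim S_\alpha((t-s)^{1/\alpha},\beta,0)$ for $0\le s<t$. **Model.** Fix $T>0$, $x_0>0$. For $\epsilon>0$ and a function $\theta$, $X=\{X_t,0\le t\le T\}$ solves $dX_t=\theta(t)X_t\,dt+\epsilon\,dZ_t$,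 $X_0=x_0$, $0\le t\le T$. Expectations are taken when $\theta$ is the true multiplier. **Function class and condition $(A_1)$.** Fix $L,L_\gamma>0$. $\Theta_\rho(L_\gamma)$, $\rho=k+\gamma$, is the class of functions $\theta$ that are uniformly bounded, $|\theta(t)|\le L$ for $t\in[0,T]$ (condition $(A_1)$), and $k$ times continuously differentiable with $|\theta^{(k)}(t)-\theta^{(k)}(s)|\le L_\gamma|t-s|^\gamma$ for all $s,t$. **Condition $(A_2)$.** $G:\mathbb{R}\to\mathbb{R}$ is a bounded function with finite support $[A,B]$, $A<0<B$: $G(u)=0$ for $u<A$ and $u>B$, and $\int_A^B G(u)\,du=1$. **Condition $(A_3)$.** $\int_{-\infty}^\infty u^jG(u)\,du=0$ for $j=1,2,\dots,k$. **Estimator.** Let $\mathcal{A}_t=\{\omega:\inf_{0\le s\le t}X_s(\omega)\ge\frac12x_0e^{-Lt}\}$ and $\mathcal{A}=\mathcal{A}_T$; $I(\cdot)$ denotes the indicator of an event. Define the process $Y$ by $$dY_t=\theta(t)I(\mathcal{A}_t)\,dt+\epsilon X_t^{-1}I(\mathcal{A}_t)\,dZ_t,\qquad 0\le t\le T,$$ where, as stochastic integrals against $Z$ are defined for predictable integrands, the integrand $X_t^{-1}I(\mathcal{A}_t)$ in the $dZ_t$ term is understood through its predictable left-limit version. The estimator is $$\tilde\theta(t)=I(\mathcal{A})\,\frac1{\varphi_\epsilon}\int_0^TG\Big(\frac{t-s}{\varphi_\epsilon}\Big)\,dY_s .$$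
   Formalization: The interval [c,d] is taken inside the open interval (0,T): with c=0 or d=T the claim fails, e.g. for k=1, G=1/2 on [-1,1], θ=L constant, the estimator at t=0 tends to L/2 instead of L. *)

theory Defs
  imports "HOL-Probability.Probability"
begin

section \<open>Stable noise\<close>

definition stable_law :: "real \<Rightarrow> real \<Rightarrow> real \<Rightarrow> real \<Rightarrow> real measure \<Rightarrow> bool" where
  "stable_law \<alpha> \<sigma> \<beta> \<mu> N \<longleftrightarrow>
     0 < \<alpha> \<and> \<alpha> \<le> 2 \<and> \<alpha> \<noteq> 1 \<and> 0 < \<sigma> \<and> -1 \<le> \<beta> \<and> \<beta> \<le> 1 \<and>
     real_distribution N \<and>
     (\<forall>u. char N u =
        exp (- complex_of_real (\<sigma> powr \<alpha> * \<bar>u\<bar> powr \<alpha>)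
               * (1 - \<i> * complex_of_real (\<beta> * sgn u * tan (\<alpha> * pi / 2)))
             + \<i> * complex_of_real (\<mu> * u)))"

definition cadlag_on :: "real set \<Rightarrow> (real \<Rightarrow> real) \<Rightarrow> bool" where
  "cadlag_on I f \<longleftrightarrow>
     (\<forall>t\<in>I. (f \<longlongrightarrow> f t) (at t within I \<inter> {t<..}) \<and>
            (\<exists>l. (f \<longlongrightarrow> l) (at t within I \<inter> {..<t})))"

text \<open>The time index of the filtration is all of \<^typ>\<open>real\<close>, to fit the locale
  \<^locale>\<open>filtration\<close>; only times \<open>t \<ge> 0\<close> are ever used.\<close>

definition right_cont_filtration :: "'a measure \<Rightarrow> (real \<Rightarrow> 'a measure) \<Rightarrow> bool" where
  "right_cont_filtration M F \<longleftrightarrow>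
     filtration (space M) F \<and> (\<forall>t. subalgebra M (F t)) \<and>
     (\<forall>t\<ge>0. sets (F t) = (\<Inter>s\<in>{t<..}. sets (F s)))"

text \<open>Independence of increments is meant relative to the filtration: \<open>Z t - Z s\<close> is independent of
  the whole past \<open>F s\<close>, and not only of the past of \<open>Z\<close>.\<close>

definition stable_levy_process ::
  "'a measure \<Rightarrow> (real \<Rightarrow> 'a measure) \<Rightarrow> real \<Rightarrow> real \<Rightarrow> (real \<Rightarrow> 'a \<Rightarrow> real) \<Rightarrow> bool" where
  "stable_levy_process M F \<alpha> \<beta> Z \<longleftrightarrow>
     (\<forall>t\<ge>0. Z t \<in> borel_measurable (F t)) \<and>
     (\<forall>\<omega>\<in>space M. cadlag_on {0..} (\<lambda>t. Z t \<omega>)) \<and>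
     (AE \<omega> in M. Z 0 \<omega> = 0) \<and>
     (\<forall>s t. 0 \<le> s \<and> s < t \<longrightarrow>
        prob_space.indep_set M (sets (F s))
          (sets (vimage_algebra (space M) (\<lambda>\<omega>. Z t \<omega> - Z s \<omega>) borel)) \<and>
        stable_law \<alpha> ((t - s) powr (1 / \<alpha>)) \<beta> 0 (distr M borel (\<lambda>\<omega>. Z t \<omega> - Z s \<omega>)))"

section \<open>Stochastic integrals of predictable processes\<close>

definition predictable_sigma :: "'a set \<Rightarrow> (real \<Rightarrow> 'a measure) \<Rightarrow> real \<Rightarrow> (real \<times> 'a) measure" where
  "predictable_sigma \<Omega> F T =
     sigma ({0<..T} \<times> \<Omega>) {{s<..t} \<times> A | s t A. 0 \<le> s \<and> s \<le> t \<and> t \<le> T \<and> A \<in> sets (F s)}"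

definition predictable ::
  "'a measure \<Rightarrow> (real \<Rightarrow> 'a measure) \<Rightarrow> real \<Rightarrow> (real \<Rightarrow> 'a \<Rightarrow> real) \<Rightarrow> bool" where
  "predictable M F T H \<longleftrightarrow>
     (\<lambda>(s, \<omega>). H s \<omega>) \<in> borel_measurable (predictable_sigma (space M) F T)"

text \<open>The triple \<open>(m, \<tau>, \<xi>)\<close> stands for the simple predictable process
  \<open>\<Sum>i<m. \<xi> i \<cdot> 1\<close> on \<open>(\<tau> i, \<tau> (i + 1)]\<close>.\<close>

definition simple_predictable ::
  "'a measure \<Rightarrow> (real \<Rightarrow> 'a measure) \<Rightarrow> real \<Rightarrow> nat \<Rightarrow> (nat \<Rightarrow> real) \<Rightarrow> (nat \<Rightarrow> 'a \<Rightarrow> real) \<Rightarrow> bool" where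
  "simple_predictable M F T m \<tau> \<xi> \<longleftrightarrow>
     0 \<le> \<tau> 0 \<and> (\<forall>i<m. \<tau> i \<le> \<tau> (Suc i)) \<and> \<tau> m \<le> T \<and>
     (\<forall>i<m. \<xi> i \<in> borel_measurable (F (\<tau> i)) \<and> bounded (\<xi> i ` space M))"

definition simple_process ::
  "nat \<Rightarrow> (nat \<Rightarrow> real) \<Rightarrow> (nat \<Rightarrow> 'a \<Rightarrow> real) \<Rightarrow> real \<Rightarrow> 'a \<Rightarrow> real" where
  "simple_process m \<tau> \<xi> s \<omega> = (\<Sum>i<m. \<xi> i \<omega> * indicat_real {\<tau> i<..\<tau> (Suc i)} s)"

definition simple_integral ::
  "(real \<Rightarrow> 'a \<Rightarrow> real) \<Rightarrow> nat \<Rightarrow> (nat \<Rightarrow> real) \<Rightarrow> (nat \<Rightarrow> 'a \<Rightarrow> real) \<Rightarrow> 'a \<Rightarrow> real" where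
  "simple_integral Z m \<tau> \<xi> \<omega> = (\<Sum>i<m. \<xi> i \<omega> * (Z (\<tau> (Suc i)) \<omega> - Z (\<tau> i) \<omega>))"

text \<open>\<open>has_stable_integral M F Z \<alpha> T H J\<close>: the random variable \<open>J\<close> is (a version of) the integral
  of \<open>H\<close> against \<open>Z\<close> over \<open>(0, T]\<close>. For a strictly \<open>\<alpha>\<close>-stable integrator the integrable
  predictable processes are those with \<open>\<integral> \<bar>H\<bar> powr \<alpha> ds < \<infinity>\<close> almost surely. The integral is
  the limit in probability of the integrals of simple predictable processes \<open>H n\<close> with
  \<open>\<integral> \<bar>H n - H\<bar> powr \<alpha> ds \<longlonglongrightarrow> 0\<close> in probability. The limit does not depend, up to null
  sets, on the approximating sequence.\<close>

definition has_stable_integral ::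
  "'a measure \<Rightarrow> (real \<Rightarrow> 'a measure) \<Rightarrow> (real \<Rightarrow> 'a \<Rightarrow> real) \<Rightarrow> real \<Rightarrow> real \<Rightarrow>
   (real \<Rightarrow> 'a \<Rightarrow> real) \<Rightarrow> ('a \<Rightarrow> real) \<Rightarrow> bool" where
  "has_stable_integral M F Z \<alpha> T H J \<longleftrightarrow>
     predictable M F T H \<and> J \<in> borel_measurable M \<and>
     (\<exists>m \<tau> \<xi>.
        (\<forall>n. simple_predictable M F T (m n) (\<tau> n) (\<xi> n)) \<and>
        (\<forall>e>0. (\<lambda>n. measure M {\<omega>\<in>space M. ennreal e <
             (\<integral>\<^sup>+s\<in>{0<..T}. ennreal (\<bar>simple_process (m n) (\<tau> n) (\<xi> n) s \<omega> - H s \<omega>\<bar> powr \<alpha>) \<partial>lborel)})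
           \<longlonglongrightarrow> 0) \<and>
        (\<forall>e>0. (\<lambda>n. measure M {\<omega>\<in>space M.
             e < \<bar>simple_integral Z (m n) (\<tau> n) (\<xi> n) \<omega> - J \<omega>\<bar>}) \<longlonglongrightarrow> 0))"

text \<open>\<open>J = \<integral> g dY\<close> over \<open>[0, T]\<close> for a deterministic \<open>g\<close> and a process with stochastic differential
  \<open>dY = a dt + b dZ\<close>, that is, \<open>\<integral> g dY = \<integral> g a dt + \<integral> g b dZ\<close>.\<close>

definition has_differential_integral ::
  "'a measure \<Rightarrow> (real \<Rightarrow> 'a measure) \<Rightarrow> (real \<Rightarrow> 'a \<Rightarrow> real) \<Rightarrow> real \<Rightarrow> real \<Rightarrow>
   (real \<Rightarrow> 'a \<Rightarrow> real) \<Rightarrow> (real \<Rightarrow> 'a \<Rightarrow> real) \<Rightarrow> (real \<Rightarrow> real) \<Rightarrow> ('a \<Rightarrow> real) \<Rightarrow> bool" where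
  "has_differential_integral M F Z \<alpha> T a b g J \<longleftrightarrow>
     (\<exists>S. has_stable_integral M F Z \<alpha> T (\<lambda>s \<omega>. g s * b s \<omega>) S \<and>
          (\<forall>\<omega>\<in>space M. J \<omega> = (LBINT s:{0..T}. g s * a s \<omega>) + S \<omega>))"

text \<open>\<open>K\<close> is a predictable left-limit version of \<open>V\<close>. Left limits are required only at almost every
  time: at exceptional times they need not exist for the discontinuous functional of the path to
  which this is applied, and integrals against \<open>Z\<close> do not depend on the values of the integrand on
  a \<open>dt \<otimes> P\<close>-null set.\<close>

definition left_limit_version ::
  "'a measure \<Rightarrow> (real \<Rightarrow> 'a measure) \<Rightarrow> real \<Rightarrow>
   (real \<Rightarrow> 'a \<Rightarrow> real) \<Rightarrow> (real \<Rightarrow> 'a \<Rightarrow> real) \<Rightarrow> bool" where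
  "left_limit_version M F T V K \<longleftrightarrow>
     predictable M F T K \<and>
     (AE \<omega> in M. AE s in lborel.
        0 < s \<and> s \<le> T \<longrightarrow> ((\<lambda>r. V r \<omega>) \<longlongrightarrow> K s \<omega>) (at_left s))"

section \<open>Model and estimator\<close>

definition sde_solution ::
  "'a measure \<Rightarrow> (real \<Rightarrow> 'a measure) \<Rightarrow> (real \<Rightarrow> 'a \<Rightarrow> real) \<Rightarrow> real \<Rightarrow> real \<Rightarrow>
   real \<Rightarrow> (real \<Rightarrow> real) \<Rightarrow> (real \<Rightarrow> 'a \<Rightarrow> real) \<Rightarrow> bool" where
  "sde_solution M F Z T x0 \<epsilon> \<theta> X \<longleftrightarrow>
     (\<forall>t\<in>{0..T}. X t \<in> borel_measurable (F t)) \<and>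
     (\<forall>\<omega>\<in>space M. cadlag_on {0..T} (\<lambda>t. X t \<omega>)) \<and>
     (AE \<omega> in M. \<forall>t\<in>{0..T}.
        X t \<omega> = x0 + (LBINT s:{0..t}. \<theta> s * X s \<omega>) + \<epsilon> * Z t \<omega>)"

text \<open>The functions matter on \<open>[0, T]\<close> only; \<open>D j\<close> is the \<open>j\<close>-th derivative there (one-sided at the
  end points).\<close>

definition hoelder_class :: "real \<Rightarrow> real \<Rightarrow> nat \<Rightarrow> real \<Rightarrow> real \<Rightarrow> (real \<Rightarrow> real) set" where
  "hoelder_class T L k \<gamma> L\<gamma> =
     {\<theta>. (\<forall>t\<in>{0..T}. \<bar>\<theta> t\<bar> \<le> L) \<and>
          (\<exists>D. D 0 = \<theta> \<and>
             (\<forall>j<k. \<forall>t\<in>{0..T}. (D j has_real_derivative D (Suc j) t) (at t within {0..T})) \<and>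
             continuous_on {0..T} (D k) \<and>
             (\<forall>s\<in>{0..T}. \<forall>t\<in>{0..T}. \<bar>D k t - D k s\<bar> \<le> L\<gamma> * \<bar>t - s\<bar> powr \<gamma>))}"

definition above_event ::
  "'a measure \<Rightarrow> real \<Rightarrow> real \<Rightarrow> (real \<Rightarrow> 'a \<Rightarrow> real) \<Rightarrow> real \<Rightarrow> 'a set" where
  "above_event M x0 L X t =
     {\<omega>\<in>space M. (INF s\<in>{0..t}. X s \<omega>) \<ge> 1 / 2 * x0 * exp (- L * t)}"

definition is_estimator ::
  "'a measure \<Rightarrow> (real \<Rightarrow> 'a measure) \<Rightarrow> (real \<Rightarrow> 'a \<Rightarrow> real) \<Rightarrow> real \<Rightarrow> real \<Rightarrow> real \<Rightarrow> real \<Rightarrow>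
   (real \<Rightarrow> real) \<Rightarrow> real \<Rightarrow> real \<Rightarrow> (real \<Rightarrow> real) \<Rightarrow> (real \<Rightarrow> 'a \<Rightarrow> real) \<Rightarrow>
   real \<Rightarrow> ('a \<Rightarrow> real) \<Rightarrow> bool" where
  "is_estimator M F Z \<alpha> T x0 L G \<phi> \<epsilon> \<theta> X t E \<longleftrightarrow>
     (\<exists>K J.
        left_limit_version M F T
          (\<lambda>s \<omega>. inverse (X s \<omega>) * indicat_real (above_event M x0 L X s) \<omega>) K \<and>
        has_differential_integral M F Z \<alpha> T
          (\<lambda>s \<omega>. \<theta> s * indicat_real (above_event M x0 L X s) \<omega>)
          (\<lambda>s \<omega>. \<epsilon> * K s \<omega>)
          (\<lambda>s. G ((t - s) / \<phi>)) J \<and>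
        (\<forall>\<omega>\<in>space M. E \<omega> = indicat_real (above_event M x0 L X T) \<omega> * (1 / \<phi> * J \<omega>)))"

end

theory Submission
  imports Defs
begin

text \<open>For a simple predictable integrand whose \<open>\<alpha>\<close>-energy \<open>\<integral> \<bar>H\<bar> powr \<alpha> ds\<close> is at most \<open>R\<close>,
  conditioning on the past of each increment and telescoping gives
  \<open>\<bar>E exp (i u \<integral> H dZ) - 1\<bar> \<le> C \<bar>u\<bar> powr \<alpha> R\<close>. Since \<open>\<bar>x\<bar>\<close> is dominated by a multiple of
  \<open>\<integral> (1 - cos (u x)) / u\<^sup>2 du\<close>, this yields \<open>E \<bar>\<integral> H dZ\<bar> \<le> C R powr (1 / \<alpha>)\<close>, and both facts pass to
  general integrands by stopping the approximating simple processes when their energy exceeds a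
  constant. The noise part of the estimator is then of order \<open>\<epsilon> \<phi> powr (1 / \<alpha> - 1)\<close>, which is the
  stated rate, and the bias is of order \<open>\<phi> powr \<rho> = \<epsilon> powr \<alpha>\<close> by Taylor expansion. Integrands that
  stop \<open>Z\<close> on a grid give the maximal inequality \<open>P (sup \<bar>Z\<bar> > r) \<le> C / r\<close>, so outside an event of
  probability \<open>O(\<epsilon>)\<close> the path stays above its threshold and every indicator in the estimator is one.
  This has to hold at all times: the threshold decreases in \<open>t\<close>, so the event at time \<open>T\<close> does not
  imply the earlier ones.\<close>

section \<open>Moments from characteristic functions\<close>

lemma norm_exp_diff_one_le:
  fixes z :: complex
  assumes "Re z \<le> 0"
  shows "norm (exp z - 1) \<le> norm z"
proof -
  have "norm (exp z - exp 0) \<le> 1 * norm (z - 0)"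
  proof (rule field_differentiable_bound[where S = "{w. Re w \<le> 0}" and f' = exp])
    show "convex {w. Re w \<le> 0}" by (rule convex_halfspace_Re_le)
  qed (use assms in \<open>auto intro!: derivative_eq_intros simp: norm_exp_eq_Re\<close>)
  then show ?thesis by simp
qed

lemma stable_law_char_bound:
  assumes "stable_law \<alpha> \<sigma> \<beta> 0 N"
  shows "norm (char N u - 1) \<le> (1 + \<bar>tan (\<alpha> * pi / 2)\<bar>) * (\<sigma> powr \<alpha> * \<bar>u\<bar> powr \<alpha>)"
proof -
  define z where "z = - complex_of_real (\<sigma> powr \<alpha> * \<bar>u\<bar> powr \<alpha>)
      * (1 - \<i> * complex_of_real (\<beta> * sgn u * tan (\<alpha> * pi / 2)))"
  have beta: "\<bar>\<beta>\<bar> \<le> 1" using assms by (auto simp: stable_law_def)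
  have "char N u = exp z" using assms by (simp add: stable_law_def z_def)
  moreover have "Re z \<le> 0" by (simp add: z_def)
  ultimately have "norm (char N u - 1) \<le> norm z" using norm_exp_diff_one_le by simp
  also have "\<dots> = \<sigma> powr \<alpha> * \<bar>u\<bar> powr \<alpha> *
      norm (1 - \<i> * complex_of_real (\<beta> * sgn u * tan (\<alpha> * pi / 2)))"
    by (simp add: z_def norm_mult)
  finally have le: "norm (char N u - 1) \<le> \<sigma> powr \<alpha> * \<bar>u\<bar> powr \<alpha> *
      norm (1 - \<i> * complex_of_real (\<beta> * sgn u * tan (\<alpha> * pi / 2)))" .
  have "norm (1 - \<i> * complex_of_real (\<beta> * sgn u * tan (\<alpha> * pi / 2)))
      \<le> norm (1::complex) + norm (\<i> * complex_of_real (\<beta> * sgn u * tan (\<alpha> * pi / 2)))"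
    by (rule norm_triangle_ineq4)
  also have "\<dots> = 1 + \<bar>\<beta>\<bar> * \<bar>sgn u\<bar> * \<bar>tan (\<alpha> * pi / 2)\<bar>"
    by (simp add: norm_mult abs_mult del: of_real_mult)
  also have "\<dots> \<le> 1 + \<bar>tan (\<alpha> * pi / 2)\<bar>"
    using beta by (auto simp: sgn_if mult_left_le_one_le)
  finally have "norm (1 - \<i> * complex_of_real (\<beta> * sgn u * tan (\<alpha> * pi / 2)))
      \<le> 1 + \<bar>tan (\<alpha> * pi / 2)\<bar>" .
  from mult_right_mono[OF this, of "\<sigma> powr \<alpha> * \<bar>u\<bar> powr \<alpha>"] le
  show ?thesis by (simp add: mult_ac)
qed

lemma abs_le_nn_integral_cos:
  fixes x :: real
  shows "ennreal \<bar>x\<bar> \<le> ennreal (4 / (1 - cos 1)) *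
    (\<integral>\<^sup>+u\<in>{0<..}. ennreal ((1 - cos (u * x)) / u\<^sup>2) \<partial>lborel)"
proof (cases "x = 0")
  case False
  define a where "a = 1 / \<bar>x\<bar>"
  have a: "0 < a" using False by (simp add: a_def)
  have c1: "cos 1 < (1::real)" using cos_monotone_0_pi[of 0 1] pi_gt3 by simp
  have "ennreal ((1 - cos 1) / (4 * a\<^sup>2)) * indicator {a..2*a} u \<le>
      ennreal ((1 - cos (u * x)) / u\<^sup>2) * indicator {0<..} u" for u
  proof (cases "u \<in> {a..2*a}")
    case True
    then have "0 < u" using a by simp
    with True have u: "0 < u" "1 \<le> u * \<bar>x\<bar>" "u * \<bar>x\<bar> \<le> 2" "u \<le> 2 * a"
      using a False by (auto simp: a_def field_simps)
    have "cos (u * x) = cos (u * \<bar>x\<bar>)" by (cases "0 \<le> x") auto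
    also have "\<dots> \<le> cos 1" using u pi_gt3 by (intro cos_monotone_0_pi_le) auto
    finally have "(1 - cos 1) / (4 * a\<^sup>2) \<le> (1 - cos (u * x)) / (4 * a\<^sup>2)"
      by (intro divide_right_mono) auto
    also have "\<dots> \<le> (1 - cos (u * x)) / u\<^sup>2"
      using u a power_mono[of u "2*a" 2] by (intro divide_left_mono) (auto simp: power_mult_distrib)
    finally show ?thesis using True u by (simp add: ennreal_leI)
  qed simp
  then have "(\<integral>\<^sup>+u\<in>{a..2*a}. ennreal ((1 - cos 1) / (4 * a\<^sup>2)) \<partial>lborel) \<le>
      (\<integral>\<^sup>+u\<in>{0<..}. ennreal ((1 - cos (u * x)) / u\<^sup>2) \<partial>lborel)"
    by (intro nn_integral_mono) auto
  also have "(\<integral>\<^sup>+u\<in>{a..2*a}. ennreal ((1 - cos 1) / (4 * a\<^sup>2)) \<partial>lborel) =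
      ennreal ((1 - cos 1) / (4 * a\<^sup>2) * a)"
    using a c1 by (subst nn_integral_cmult_indicator) (auto simp: ennreal_mult[symmetric])
  also have "(1 - cos 1) / (4 * a\<^sup>2) * a = (1 - cos 1) / 4 * \<bar>x\<bar>"
    using False by (simp add: a_def power2_eq_square field_simps)
  finally have *: "ennreal ((1 - cos 1) / 4 * \<bar>x\<bar>) \<le>
      (\<integral>\<^sup>+u\<in>{0<..}. ennreal ((1 - cos (u * x)) / u\<^sup>2) \<partial>lborel)" .
  have "ennreal \<bar>x\<bar> = ennreal (4 / (1 - cos 1)) * ennreal ((1 - cos 1) / 4 * \<bar>x\<bar>)"
    using c1 by (subst ennreal_mult[symmetric]) auto
  also have "\<dots> \<le> ennreal (4 / (1 - cos 1)) *
      (\<integral>\<^sup>+u\<in>{0<..}. ennreal ((1 - cos (u * x)) / u\<^sup>2) \<partial>lborel)"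
    by (intro mult_left_mono *) auto
  finally show ?thesis .
qed simp

definition moment_const :: "real \<Rightarrow> real" where
  "moment_const \<alpha> = 4 / (1 - cos 1) * (1 / (\<alpha> - 1) + 2)"

lemma moment_const_nonneg: "1 < \<alpha> \<Longrightarrow> 0 \<le> moment_const \<alpha>"
  by (auto simp: moment_const_def)

text \<open>The integral over \<open>u\<close> splits at the scale \<open>c powr (-1 / \<alpha>)\<close>: below it the assumed bound is
  used, above it the trivial bound \<open>1 - cos \<le> 2\<close>.\<close>

lemma (in prob_space) abs_moment_le_char:
  fixes Y :: "'a \<Rightarrow> real"
  assumes [measurable]: "random_variable borel Y" and alpha: "1 < \<alpha>" and c: "0 < c"
    and char: "\<And>u. 0 < u \<Longrightarrow> norm ((\<integral>\<omega>. iexp (u * Y \<omega>) \<partial>M) - 1) \<le> c * u powr \<alpha>"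
  shows "(\<integral>\<^sup>+\<omega>. ennreal \<bar>Y \<omega>\<bar> \<partial>M) \<le> ennreal (moment_const \<alpha> * c powr (1 / \<alpha>))"
proof -
  interpret P: pair_sigma_finite M lborel ..
  define a where "a = c powr (- 1 / \<alpha>)"
  have a: "0 < a" using c by (simp add: a_def)
  have inner: "(\<integral>\<^sup>+\<omega>. ennreal ((1 - cos (u * Y \<omega>)) / u\<^sup>2) \<partial>M) \<le>
      ennreal (min (c * u powr \<alpha>) 2 / u\<^sup>2)" if u: "0 < u" for u
  proof -
    have int: "integrable M (\<lambda>\<omega>. cos (u * Y \<omega>))"
      by (rule integrable_const_bound[where B = 1]) auto
    have inti: "integrable M (\<lambda>\<omega>. iexp (u * Y \<omega>))"
      by (rule integrable_const_bound[where B = 1]) auto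
    have "(\<integral>\<^sup>+\<omega>. ennreal ((1 - cos (u * Y \<omega>)) / u\<^sup>2) \<partial>M) =
        ennreal (\<integral>\<omega>. (1 - cos (u * Y \<omega>)) / u\<^sup>2 \<partial>M)"
      using int by (intro nn_integral_eq_integral) auto
    also have "(\<integral>\<omega>. (1 - cos (u * Y \<omega>)) / u\<^sup>2 \<partial>M) = (1 - (\<integral>\<omega>. cos (u * Y \<omega>) \<partial>M)) / u\<^sup>2"
      using int by (simp add: prob_space)
    also have "(\<integral>\<omega>. cos (u * Y \<omega>) \<partial>M) = Re (\<integral>\<omega>. iexp (u * Y \<omega>) \<partial>M)"
      using inti by (subst integral_Re[symmetric]) (auto simp: Re_exp)
    also have "1 - Re (\<integral>\<omega>. iexp (u * Y \<omega>) \<partial>M) \<le> min (c * u powr \<alpha>) 2"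
    proof -
      have "1 - Re (\<integral>\<omega>. iexp (u * Y \<omega>) \<partial>M) \<le> c * u powr \<alpha>"
        using char[OF u] abs_Re_le_cmod[of "(\<integral>\<omega>. iexp (u * Y \<omega>) \<partial>M) - 1"] by simp
      moreover have "norm (\<integral>\<omega>. iexp (u * Y \<omega>) \<partial>M) \<le> (\<integral>\<omega>. norm (iexp (u * Y \<omega>)) \<partial>M)"
        by (rule integral_norm_bound)
      moreover have "(\<integral>\<omega>. norm (iexp (u * Y \<omega>)) \<partial>M) = 1" by (simp add: prob_space)
      ultimately show ?thesis
        using abs_Re_le_cmod[of "\<integral>\<omega>. iexp (u * Y \<omega>) \<partial>M"] by simp
    qed
    finally show ?thesis using u by (simp add: ennreal_leI divide_right_mono)
  qed
  have low: "(\<integral>\<^sup>+u. ennreal (c * (u powr (\<alpha> - 2) * indicator {0..a} u)) \<partial>lborel) =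
      ennreal (c * (a powr (\<alpha> - 1) / (\<alpha> - 1)))"
  proof (rule nn_integral_has_integral_lborel)
    have "((\<lambda>u. u powr (\<alpha> - 2)) has_integral (a powr (\<alpha> - 2 + 1) / (\<alpha> - 2 + 1))) {0..a}"
      using alpha a by (intro has_integral_powr_from_0) auto
    then have "((\<lambda>u. u powr (\<alpha> - 2) * indicator {0..a} u) has_integral
        (a powr (\<alpha> - 1) / (\<alpha> - 1))) UNIV"
      by (subst (asm) has_integral_restrict_UNIV[symmetric])
         (simp add: indicator_def if_distrib of_bool_def cong: if_cong)
    then show "((\<lambda>u. c * (u powr (\<alpha> - 2) * indicator {0..a} u)) has_integral
        (c * (a powr (\<alpha> - 1) / (\<alpha> - 1)))) UNIV"
      by (rule has_integral_mult_right)
  qed (use c in \<open>auto intro!: mult_nonneg_nonneg\<close>)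
  have "((\<lambda>u. - 2 / u) \<longlongrightarrow> 0) (at_top :: real filter)"
    by (intro tendsto_divide_0[OF tendsto_const]) (rule filterlim_at_top_imp_at_infinity[OF filterlim_ident])
  then have "(\<integral>\<^sup>+u. ennreal (2 / u\<^sup>2) * indicator {a..} u \<partial>lborel) = ennreal (0 - (- 2 / a))"
    using a by (intro nn_integral_FTC_atLeast)
      (auto intro!: derivative_eq_intros simp: power2_eq_square)
  then have high: "(\<integral>\<^sup>+u. ennreal (2 / u\<^sup>2) * indicator {a..} u \<partial>lborel) = ennreal (2 / a)"
    by simp
  have "(\<integral>\<^sup>+\<omega>. ennreal \<bar>Y \<omega>\<bar> \<partial>M) \<le> (\<integral>\<^sup>+\<omega>. ennreal (4 / (1 - cos 1)) *
      (\<integral>\<^sup>+u\<in>{0<..}. ennreal ((1 - cos (u * Y \<omega>)) / u\<^sup>2) \<partial>lborel) \<partial>M)"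
    by (intro nn_integral_mono abs_le_nn_integral_cos)
  also have "\<dots> = ennreal (4 / (1 - cos 1)) * (\<integral>\<^sup>+\<omega>.
      (\<integral>\<^sup>+u\<in>{0<..}. ennreal ((1 - cos (u * Y \<omega>)) / u\<^sup>2) \<partial>lborel) \<partial>M)"
    by (intro nn_integral_cmult) measurable
  also have "(\<integral>\<^sup>+\<omega>. (\<integral>\<^sup>+u\<in>{0<..}. ennreal ((1 - cos (u * Y \<omega>)) / u\<^sup>2) \<partial>lborel) \<partial>M) =
      (\<integral>\<^sup>+u. (\<integral>\<^sup>+\<omega>. ennreal ((1 - cos (u * Y \<omega>)) / u\<^sup>2) * indicator {0<..} u \<partial>M) \<partial>lborel)"
    by (rule P.Fubini'[symmetric]) measurable
  also have "\<dots> = (\<integral>\<^sup>+u. (\<integral>\<^sup>+\<omega>. ennreal ((1 - cos (u * Y \<omega>)) / u\<^sup>2) \<partial>M) * indicator {0<..} u \<partial>lborel)"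
    by (intro nn_integral_cong nn_integral_multc) auto
  also have "\<dots> \<le> (\<integral>\<^sup>+u. ennreal (c * (u powr (\<alpha> - 2) * indicator {0..a} u)) +
      ennreal (2 / u\<^sup>2) * indicator {a..} u \<partial>lborel)"
  proof (rule nn_integral_mono)
    fix u :: real
    show "(\<integral>\<^sup>+\<omega>. ennreal ((1 - cos (u * Y \<omega>)) / u\<^sup>2) \<partial>M) * indicator {0<..} u \<le>
      ennreal (c * (u powr (\<alpha> - 2) * indicator {0..a} u)) + ennreal (2 / u\<^sup>2) * indicator {a..} u"
    proof (cases "0 < u")
      case True
      have powr2: "c * u powr \<alpha> / u\<^sup>2 = c * u powr (\<alpha> - 2)"
        using True by (simp add: powr_diff)
      show ?thesis
      proof (cases "u \<le> a")
        case le: True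
        have "min (c * u powr \<alpha>) 2 / u\<^sup>2 \<le> c * u powr (\<alpha> - 2)"
          unfolding powr2[symmetric] by (intro divide_right_mono) auto
        then have "(\<integral>\<^sup>+\<omega>. ennreal ((1 - cos (u * Y \<omega>)) / u\<^sup>2) \<partial>M) \<le> ennreal (c * u powr (\<alpha> - 2))"
          using inner[OF True] by (meson ennreal_leI order_trans)
        then show ?thesis using True le by (simp add: add_increasing2)
      next
        case False
        have "min (c * u powr \<alpha>) 2 / u\<^sup>2 \<le> 2 / u\<^sup>2"
          by (intro divide_right_mono) auto
        then have "(\<integral>\<^sup>+\<omega>. ennreal ((1 - cos (u * Y \<omega>)) / u\<^sup>2) \<partial>M) \<le> ennreal (2 / u\<^sup>2)"
          using inner[OF True] by (meson ennreal_leI order_trans)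
        then show ?thesis using True False by simp
      qed
    qed simp
  qed
  also have "\<dots> = ennreal (c * (a powr (\<alpha> - 1) / (\<alpha> - 1))) + ennreal (2 / a)"
    by (subst nn_integral_add) (auto simp: low high)
  also have "\<dots> = ennreal (c powr (1 / \<alpha>) * (1 / (\<alpha> - 1) + 2))"
  proof -
    have "c * a powr (\<alpha> - 1) = c powr (1 + (- 1 / \<alpha>) * (\<alpha> - 1))"
      using c by (simp add: a_def powr_powr powr_mult_base)
    also have "1 + (- 1 / \<alpha>) * (\<alpha> - 1) = 1 / \<alpha>"
      using alpha by (simp add: field_simps)
    finally have *: "c * a powr (\<alpha> - 1) = c powr (1 / \<alpha>)" .
    have "1 / a = c powr (1 / \<alpha>)" using c by (simp add: a_def powr_minus_divide)
    then have "2 / a = 2 * c powr (1 / \<alpha>)" by (metis times_divide_eq_right mult.right_neutral)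
    then show ?thesis
      using alpha a c * by (subst ennreal_plus[symmetric]) (auto simp: algebra_simps)
  qed
  finally have "(\<integral>\<^sup>+\<omega>. ennreal \<bar>Y \<omega>\<bar> \<partial>M) \<le>
      ennreal (4 / (1 - cos 1)) * ennreal (c powr (1 / \<alpha>) * (1 / (\<alpha> - 1) + 2))"
    by (simp add: mult_left_mono)
  then show ?thesis
    using alpha by (simp add: moment_const_def ennreal_mult'[symmetric] mult_ac)
qed

section \<open>Moments of stable integrals\<close>

definition char_const :: "real \<Rightarrow> real" where
  "char_const \<alpha> = 1 + \<bar>tan (\<alpha> * pi / 2)\<bar>"

lemma char_const_ge_1: "1 \<le> char_const \<alpha>"
  by (simp add: char_const_def)

locale stable_noise = prob_space M for M :: "'a measure" +
  fixes F :: "real \<Rightarrow> 'a measure" and Z :: "real \<Rightarrow> 'a \<Rightarrow> real" and \<alpha> \<beta> :: real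
  assumes alpha: "1 < \<alpha>"
    and filt: "right_cont_filtration M F"
    and noise: "stable_levy_process M F \<alpha> \<beta> Z"
begin

lemma space_F [simp]: "space (F t) = space M"
  and sets_F_le: "sets (F t) \<subseteq> sets M"
  using filt by (auto simp: right_cont_filtration_def subalgebra_def)

lemma sets_F_mono: "s \<le> t \<Longrightarrow> sets (F s) \<subseteq> sets (F t)"
  using filt by (auto simp: right_cont_filtration_def filtration_def)

lemma measurable_F_mono:
  "f \<in> measurable (F s) N \<Longrightarrow> s \<le> t \<Longrightarrow> f \<in> measurable (F t) N"
  using sets_F_mono[of s t] by (auto simp: measurable_def dest: subsetD)

lemma measurable_F_M: "f \<in> measurable (F s) N \<Longrightarrow> f \<in> measurable M N"
  using sets_F_le by (auto simp: measurable_def)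

lemma Z_adapted: "0 \<le> t \<Longrightarrow> Z t \<in> borel_measurable (F t)"
  using noise by (simp add: stable_levy_process_def)

lemma Z_measurable: "0 \<le> t \<Longrightarrow> Z t \<in> borel_measurable M"
  using Z_adapted measurable_F_M by blast

lemma char_step:
  assumes st: "0 \<le> s" "s \<le> t"
    and X: "X \<in> borel_measurable (F s)" and \<xi>: "\<xi> \<in> borel_measurable (F s)"
    and bnd: "bounded (\<xi> ` space M)"
  shows "norm ((\<integral>\<omega>. iexp (u * (X \<omega> + \<xi> \<omega> * (Z t \<omega> - Z s \<omega>))) \<partial>M) - (\<integral>\<omega>. iexp (u * X \<omega>) \<partial>M))
    \<le> char_const \<alpha> * \<bar>u\<bar> powr \<alpha> * (\<integral>\<omega>. \<bar>\<xi> \<omega>\<bar> powr \<alpha> * (t - s) \<partial>M)"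
proof (cases "s = t")
  case False
  then have st': "s < t" using st by simp
  define D where "D = (\<lambda>\<omega>. Z t \<omega> - Z s \<omega>)"
  define W where "W = (\<lambda>\<omega>. (X \<omega>, \<xi> \<omega>))"
  define V where "V = (\<lambda>\<omega>. (D \<omega>, 0 :: real))"
  define B where "B = (borel \<Otimes>\<^sub>M borel :: (real \<times> real) measure)"
  define N where "N = distr M borel D"
  have [measurable]: "Z s \<in> borel_measurable M" "Z t \<in> borel_measurable M"
    using st by (auto intro: Z_measurable)
  note [measurable] = measurable_F_M[OF X] measurable_F_M[OF \<xi>]
  have [measurable]: "D \<in> borel_measurable M"
    unfolding D_def by measurable
  have VD: "V \<in> measurable (vimage_algebra (space M) D borel) B"
    unfolding V_def B_def by (intro measurable_Pair measurable_vimage_algebra1) auto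
  have [measurable]: "V \<in> measurable M B"
    unfolding V_def B_def by measurable
  have WF: "W \<in> measurable (F s) B"
    unfolding W_def B_def using X \<xi> by measurable
  have [measurable]: "W \<in> measurable M B"
    by (rule measurable_F_M[OF WF])
  have indep: "indep_set (sets (F s)) (sets (vimage_algebra (space M) D borel))"
    and law: "stable_law \<alpha> ((t - s) powr (1 / \<alpha>)) \<beta> 0 N"
    using noise st st' unfolding stable_levy_process_def D_def N_def by auto
  have "indep_set (sigma_sets (space M) {W -` A \<inter> space M | A. A \<in> sets B})
      (sigma_sets (space M) {V -` A \<inter> space M | A. A \<in> sets B})"
  proof (rule indep_setI)
    have subW: "sigma_sets (space M) {W -` A \<inter> space M | A. A \<in> sets B} \<subseteq> sets (F s)"
      using measurable_sets[OF WF] by (intro sets.sigma_sets_subset[of _ "F s", simplified]) auto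
    then show "sigma_sets (space M) {W -` A \<inter> space M | A. A \<in> sets B} \<subseteq> events"
      using sets_F_le by blast
    have subV: "sigma_sets (space M) {V -` A \<inter> space M | A. A \<in> sets B} \<subseteq>
        sets (vimage_algebra (space M) D borel)"
      using measurable_sets[OF VD]
      by (intro sets.sigma_sets_subset[of _ "vimage_algebra (space M) D borel", simplified]) auto
    then show "sigma_sets (space M) {V -` A \<inter> space M | A. A \<in> sets B} \<subseteq> events"
      using indep_setD_ev2[OF indep] by simp
    fix a b
    assume "a \<in> sigma_sets (space M) {W -` A \<inter> space M | A. A \<in> sets B}"
      "b \<in> sigma_sets (space M) {V -` A \<inter> space M | A. A \<in> sets B}"
    then show "prob (a \<inter> b) = prob a * prob b"
      using subW subV by (intro indep_setD[OF indep]) auto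
  qed
  then have "indep_var B W B V"
    unfolding indep_var_eq by simp
  then have joint: "distr M B W \<Otimes>\<^sub>M distr M B V = distr M (B \<Otimes>\<^sub>M B) (\<lambda>\<omega>. (W \<omega>, V \<omega>))"
    unfolding indep_var_distribution_eq by blast
  define P where "P = distr M B W"
  define Q where "Q = distr M B V"
  interpret P: prob_space P unfolding P_def by (rule prob_space_distr) simp
  interpret Q: prob_space Q unfolding Q_def by (rule prob_space_distr) simp
  interpret N: real_distribution N using law by (simp add: stable_law_def)
  interpret PQ: pair_prob_space P Q ..
  have setsQ [measurable_cong]: "sets Q = sets (borel \<Otimes>\<^sub>M borel)" by (simp add: Q_def B_def)
  have setsP [measurable_cong]: "sets P = sets (borel \<Otimes>\<^sub>M borel)" by (simp add: P_def B_def)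
  have setsB [measurable_cong]: "sets B = sets (borel \<Otimes>\<^sub>M borel)" by (simp add: B_def)
  have "(\<integral>\<omega>. iexp (u * (X \<omega> + \<xi> \<omega> * D \<omega>)) \<partial>M) =
      (\<integral>p. iexp (u * (fst (fst p) + snd (fst p) * fst (snd p))) \<partial>(distr M (B \<Otimes>\<^sub>M B) (\<lambda>\<omega>. (W \<omega>, V \<omega>))))"
    by (subst integral_distr) (auto simp: W_def V_def)
  also have "\<dots> = (\<integral>p. iexp (u * (fst (fst p) + snd (fst p) * fst (snd p))) \<partial>(P \<Otimes>\<^sub>M Q))"
    by (simp add: joint P_def Q_def)
  also have "\<dots> = (\<integral>w. (\<integral>y. iexp (u * (fst w + snd w * fst y)) \<partial>Q) \<partial>P)"
  proof -
    have "integrable (P \<Otimes>\<^sub>M Q) (\<lambda>p. iexp (u * (fst (fst p) + snd (fst p) * fst (snd p))))"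
      by (rule PQ.integrable_const_bound[where B = 1]) auto
    from PQ.integral_fst'[OF this] show ?thesis by (simp only: fst_conv snd_conv)
  qed
  also have "\<dots> = (\<integral>w. iexp (u * fst w) * char N (u * snd w) \<partial>P)"
  proof (rule Bochner_Integration.integral_cong)
    fix w :: "real \<times> real"
    have "(\<integral>y. iexp (u * (fst w + snd w * fst y)) \<partial>Q) =
        (\<integral>y. iexp (u * fst w) * iexp ((u * snd w) * fst y) \<partial>Q)"
      unfolding mult_exp_exp by (simp only: of_real_add of_real_mult distrib_left mult.assoc)
    also have "\<dots> = iexp (u * fst w) * (\<integral>y. iexp ((u * snd w) * fst y) \<partial>Q)"
      by (rule integral_mult_right_zero)
    also have "(\<integral>y. iexp ((u * snd w) * fst y) \<partial>Q) = char N (u * snd w)"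
      unfolding char_def N_def Q_def
      by (subst (1 2) integral_distr) (auto simp: V_def)
    finally show "(\<integral>y. iexp (u * (fst w + snd w * fst y)) \<partial>Q) = iexp (u * fst w) * char N (u * snd w)" .
  qed simp
  also have "\<dots> = (\<integral>\<omega>. iexp (u * X \<omega>) * char N (u * \<xi> \<omega>) \<partial>M)"
    unfolding P_def by (subst integral_distr) (auto simp: W_def)
  finally have eq: "(\<integral>\<omega>. iexp (u * (X \<omega> + \<xi> \<omega> * D \<omega>)) \<partial>M) =
      (\<integral>\<omega>. iexp (u * X \<omega>) * char N (u * \<xi> \<omega>) \<partial>M)" .
  have int1: "integrable M (\<lambda>\<omega>. iexp (u * X \<omega>) * char N (u * \<xi> \<omega>))"
    using N.cmod_char_le_1
    by (intro integrable_const_bound[where B = 1]) (auto simp: norm_mult)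
  have int2: "integrable M (\<lambda>\<omega>. iexp (u * X \<omega>))"
    by (rule integrable_const_bound[where B = 1]) auto
  obtain b where b: "\<And>\<omega>. \<omega> \<in> space M \<Longrightarrow> \<bar>\<xi> \<omega>\<bar> \<le> b"
    using bnd by (auto simp: bounded_iff)
  have int3: "integrable M (\<lambda>\<omega>. \<bar>\<xi> \<omega>\<bar> powr \<alpha> * (t - s))"
  proof (rule integrable_const_bound[where B = "b powr \<alpha> * (t - s)"])
    show "AE \<omega> in M. norm (\<bar>\<xi> \<omega>\<bar> powr \<alpha> * (t - s)) \<le> b powr \<alpha> * (t - s)"
      using b st alpha by (auto intro!: AE_I2 mult_right_mono powr_mono2 simp: abs_mult)
  qed measurable
  have "(\<integral>\<omega>. iexp (u * (X \<omega> + \<xi> \<omega> * D \<omega>)) \<partial>M) - (\<integral>\<omega>. iexp (u * X \<omega>) \<partial>M) =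
      (\<integral>\<omega>. iexp (u * X \<omega>) * (char N (u * \<xi> \<omega>) - 1) \<partial>M)"
    unfolding eq using int1 int2 by (simp add: right_diff_distrib)
  also have "norm \<dots> \<le> (\<integral>\<omega>. norm (iexp (u * X \<omega>) * (char N (u * \<xi> \<omega>) - 1)) \<partial>M)"
    by (rule integral_norm_bound)
  also have "\<dots> \<le> (\<integral>\<omega>. char_const \<alpha> * \<bar>u\<bar> powr \<alpha> * (\<bar>\<xi> \<omega>\<bar> powr \<alpha> * (t - s)) \<partial>M)"
  proof (rule integral_mono)
    show "integrable M (\<lambda>\<omega>. norm (iexp (u * X \<omega>) * (char N (u * \<xi> \<omega>) - 1)))"
      using int1 int2 by (auto simp: right_diff_distrib)
    show "integrable M (\<lambda>\<omega>. char_const \<alpha> * \<bar>u\<bar> powr \<alpha> * (\<bar>\<xi> \<omega>\<bar> powr \<alpha> * (t - s)))"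
      by (intro integrable_mult_right int3)
    fix \<omega>
    have "norm (char N (u * \<xi> \<omega>) - 1) \<le>
        char_const \<alpha> * (((t - s) powr (1 / \<alpha>)) powr \<alpha> * \<bar>u * \<xi> \<omega>\<bar> powr \<alpha>)"
      unfolding char_const_def by (rule stable_law_char_bound[OF law])
    also have "((t - s) powr (1 / \<alpha>)) powr \<alpha> = t - s"
      using alpha st' by (simp add: powr_powr)
    also have "\<bar>u * \<xi> \<omega>\<bar> powr \<alpha> = \<bar>u\<bar> powr \<alpha> * \<bar>\<xi> \<omega>\<bar> powr \<alpha>"
      by (simp add: abs_mult powr_mult)
    finally show "norm (iexp (u * X \<omega>) * (char N (u * \<xi> \<omega>) - 1)) \<le>
        char_const \<alpha> * \<bar>u\<bar> powr \<alpha> * (\<bar>\<xi> \<omega>\<bar> powr \<alpha> * (t - s))"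
      by (simp add: norm_mult mult_ac)
  qed
  also have "\<dots> = char_const \<alpha> * \<bar>u\<bar> powr \<alpha> * (\<integral>\<omega>. \<bar>\<xi> \<omega>\<bar> powr \<alpha> * (t - s) \<partial>M)"
    by (rule integral_mult_right_zero)
  finally show ?thesis by (simp add: D_def)
qed simp

lemma simple_predictable_times:
  assumes "simple_predictable M F T m \<tau> \<xi>" "i \<le> m"
  shows "0 \<le> \<tau> i"
  using assms(2)
proof (induction i)
  case (Suc i)
  then have "\<tau> i \<le> \<tau> (Suc i)" using assms(1) by (auto simp: simple_predictable_def)
  with Suc show ?case by simp
qed (use assms in \<open>simp add: simple_predictable_def\<close>)

lemma simple_predictable_times_mono:
  assumes "simple_predictable M F T m \<tau> \<xi>" "i \<le> j" "j \<le> m"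
  shows "\<tau> i \<le> \<tau> j"
  using assms(2,3)
proof (induction j rule: dec_induct)
  case (step j)
  then have "\<tau> j \<le> \<tau> (Suc j)" using assms(1) by (auto simp: simple_predictable_def)
  with step show ?case by simp
qed simp

lemma simple_predictable_Suc:
  assumes "simple_predictable M F T (Suc m) \<tau> \<xi>"
  shows "simple_predictable M F T m \<tau> \<xi>"
  using assms by (auto simp: simple_predictable_def)

lemma simple_integral_adapted:
  assumes "simple_predictable M F T m \<tau> \<xi>"
  shows "simple_integral Z m \<tau> \<xi> \<in> borel_measurable (F (\<tau> m))"
proof -
  have "(\<lambda>\<omega>. \<xi> i \<omega> * (Z (\<tau> (Suc i)) \<omega> - Z (\<tau> i) \<omega>)) \<in> borel_measurable (F (\<tau> m))" if "i < m" for i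
  proof -
    have "\<xi> i \<in> borel_measurable (F (\<tau> i))"
      using that assms by (auto simp: simple_predictable_def)
    then have [measurable]: "\<xi> i \<in> borel_measurable (F (\<tau> m))"
      by (rule measurable_F_mono) (use that in \<open>intro simple_predictable_times_mono[OF assms], auto\<close>)
    have Z: "Z (\<tau> j) \<in> borel_measurable (F (\<tau> m))" if "j \<le> m" for j
      using that by (intro measurable_F_mono[OF Z_adapted] simple_predictable_times[OF assms]
          simple_predictable_times_mono[OF assms]) auto
    have [measurable]: "Z (\<tau> i) \<in> borel_measurable (F (\<tau> m))"
      "Z (\<tau> (Suc i)) \<in> borel_measurable (F (\<tau> m))"
      using that by (auto intro!: Z)
    show ?thesis by measurable
  qed
  then show ?thesis unfolding simple_integral_def[abs_def] by (intro borel_measurable_sum) auto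
qed

lemmas simple_integral_measurable = measurable_F_M[OF simple_integral_adapted]

lemma simple_integrable:
  assumes "simple_predictable M F T m \<tau> \<xi>" "i < m"
  shows "integrable M (\<lambda>\<omega>. \<bar>\<xi> i \<omega>\<bar> powr \<alpha> * (\<tau> (Suc i) - \<tau> i))"
proof -
  have \<xi>: "\<xi> i \<in> borel_measurable (F (\<tau> i))" and bnd: "bounded (\<xi> i ` space M)"
    and le: "\<tau> i \<le> \<tau> (Suc i)"
    using assms by (auto simp: simple_predictable_def)
  note [measurable] = measurable_F_M[OF \<xi>]
  obtain b where b: "\<And>\<omega>. \<omega> \<in> space M \<Longrightarrow> \<bar>\<xi> i \<omega>\<bar> \<le> b"
    using bnd by (auto simp: bounded_iff)
  show ?thesis
  proof (rule integrable_const_bound[where B = "b powr \<alpha> * (\<tau> (Suc i) - \<tau> i)"])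
    show "AE \<omega> in M. norm (\<bar>\<xi> i \<omega>\<bar> powr \<alpha> * (\<tau> (Suc i) - \<tau> i)) \<le> b powr \<alpha> * (\<tau> (Suc i) - \<tau> i)"
      using b le alpha by (auto intro!: AE_I2 mult_right_mono powr_mono2 simp: abs_mult)
  qed measurable
qed

lemma simple_integral_char_sum:
  assumes "simple_predictable M F T m \<tau> \<xi>"
  shows "norm ((\<integral>\<omega>. iexp (u * simple_integral Z m \<tau> \<xi> \<omega>) \<partial>M) - 1)
    \<le> char_const \<alpha> * \<bar>u\<bar> powr \<alpha> * (\<Sum>i<m. \<integral>\<omega>. \<bar>\<xi> i \<omega>\<bar> powr \<alpha> * (\<tau> (Suc i) - \<tau> i) \<partial>M)"
  using assms
proof (induction m)
  case 0
  then show ?case by (simp add: simple_integral_def prob_space)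
next
  case (Suc m)
  note sp = simple_predictable_Suc[OF Suc.prems]
  let ?S = "simple_integral Z m \<tau> \<xi>"
  have "norm ((\<integral>\<omega>. iexp (u * (?S \<omega> + \<xi> m \<omega> * (Z (\<tau> (Suc m)) \<omega> - Z (\<tau> m) \<omega>))) \<partial>M)
      - (\<integral>\<omega>. iexp (u * ?S \<omega>) \<partial>M))
    \<le> char_const \<alpha> * \<bar>u\<bar> powr \<alpha> * (\<integral>\<omega>. \<bar>\<xi> m \<omega>\<bar> powr \<alpha> * (\<tau> (Suc m) - \<tau> m) \<partial>M)"
    using Suc.prems simple_predictable_times[OF sp]
    by (intro char_step simple_integral_adapted[OF sp]) (auto simp: simple_predictable_def)
  moreover have "?S \<omega> + \<xi> m \<omega> * (Z (\<tau> (Suc m)) \<omega> - Z (\<tau> m) \<omega>) = simple_integral Z (Suc m) \<tau> \<xi> \<omega>" for \<omega>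
    by (simp add: simple_integral_def)
  ultimately show ?case
    using Suc.IH[OF sp] norm_triangle_ineq[of
      "(\<integral>\<omega>. iexp (u * simple_integral Z (Suc m) \<tau> \<xi> \<omega>) \<partial>M) - (\<integral>\<omega>. iexp (u * ?S \<omega>) \<partial>M)"
      "(\<integral>\<omega>. iexp (u * ?S \<omega>) \<partial>M) - 1"]
    by (simp add: distrib_left del: of_real_mult)
qed

lemma simple_integral_char_bound:
  assumes sp: "simple_predictable M F T m \<tau> \<xi>"
    and R: "\<And>\<omega>. \<omega> \<in> space M \<Longrightarrow> (\<Sum>i<m. \<bar>\<xi> i \<omega>\<bar> powr \<alpha> * (\<tau> (Suc i) - \<tau> i)) \<le> R"
  shows "norm ((\<integral>\<omega>. iexp (u * simple_integral Z m \<tau> \<xi> \<omega>) \<partial>M) - 1)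
    \<le> char_const \<alpha> * \<bar>u\<bar> powr \<alpha> * R"
proof -
  note int = simple_integrable[OF sp]
  have "(\<Sum>i<m. \<integral>\<omega>. \<bar>\<xi> i \<omega>\<bar> powr \<alpha> * (\<tau> (Suc i) - \<tau> i) \<partial>M) =
      (\<integral>\<omega>. (\<Sum>i<m. \<bar>\<xi> i \<omega>\<bar> powr \<alpha> * (\<tau> (Suc i) - \<tau> i)) \<partial>M)"
    using int by (subst Bochner_Integration.integral_sum) auto
  also have "\<dots> \<le> (\<integral>\<omega>. R \<partial>M)"
    using int R by (intro integral_mono Bochner_Integration.integrable_sum) auto
  finally have "(\<Sum>i<m. \<integral>\<omega>. \<bar>\<xi> i \<omega>\<bar> powr \<alpha> * (\<tau> (Suc i) - \<tau> i) \<partial>M) \<le> R"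
    by (simp add: prob_space)
  then have "char_const \<alpha> * \<bar>u\<bar> powr \<alpha> * (\<Sum>i<m. \<integral>\<omega>. \<bar>\<xi> i \<omega>\<bar> powr \<alpha> * (\<tau> (Suc i) - \<tau> i) \<partial>M)
      \<le> char_const \<alpha> * \<bar>u\<bar> powr \<alpha> * R"
    using char_const_ge_1[of \<alpha>] by (intro mult_left_mono) auto
  then show ?thesis using simple_integral_char_sum[OF sp, of u] by linarith
qed

end

lemma powr_le_quasi_triangle:
  fixes a b c p :: real
  assumes "0 \<le> p" "\<bar>b\<bar> \<le> c"
  shows "\<bar>a\<bar> powr p \<le> 2 powr p * (\<bar>a - b\<bar> powr p + c powr p)"
proof -
  have "\<bar>a\<bar> \<le> 2 * max \<bar>a - b\<bar> c" using assms(2) by (auto simp: max_def abs_if split: if_splits)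
  then have "\<bar>a\<bar> powr p \<le> (2 * max \<bar>a - b\<bar> c) powr p"
    using assms(1) by (intro powr_mono2) auto
  also have "\<dots> = 2 powr p * max (\<bar>a - b\<bar> powr p) (c powr p)"
    using assms by (auto simp: powr_mult max_def powr_mono2 intro: antisym)
  also have "\<dots> \<le> 2 powr p * (\<bar>a - b\<bar> powr p + c powr p)"
    by (intro mult_left_mono) auto
  finally show ?thesis .
qed

lemma sum_stopped_le:
  fixes a :: "nat \<Rightarrow> real"
  assumes "\<And>i. i < m \<Longrightarrow> 0 \<le> a i" "0 \<le> Q"
  shows "(\<Sum>i<m. if (\<Sum>j<Suc i. a j) \<le> Q then a i else 0) \<le> Q"
  using assms(1)
proof (induction m)
  case (Suc m)
  show ?case
  proof (cases "(\<Sum>j<Suc m. a j) \<le> Q")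
    case True
    have "(\<Sum>i<Suc m. if (\<Sum>j<Suc i. a j) \<le> Q then a i else 0) \<le> (\<Sum>i<Suc m. a i)"
      using Suc.prems by (intro sum_mono) auto
    with True show ?thesis by linarith
  next
    case False
    then show ?thesis using Suc by simp
  qed
qed (use assms in simp)

lemma simple_process_nn_integral_ge:
  assumes \<tau>: "\<And>i j. i \<le> j \<Longrightarrow> j \<le> m \<Longrightarrow> \<tau> i \<le> \<tau> j" and T: "0 \<le> \<tau> 0" "\<tau> m \<le> T"
  shows "ennreal (\<Sum>i<m. \<bar>\<xi> i \<omega>\<bar> powr \<alpha> * (\<tau> (Suc i) - \<tau> i)) \<le>
    (\<integral>\<^sup>+s\<in>{0<..T}. ennreal (\<bar>simple_process m \<tau> \<xi> s \<omega>\<bar> powr \<alpha>) \<partial>lborel)"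
proof -
  have "ennreal (\<Sum>i<m. \<bar>\<xi> i \<omega>\<bar> powr \<alpha> * (\<tau> (Suc i) - \<tau> i)) =
      (\<Sum>i<m. ennreal (\<bar>\<xi> i \<omega>\<bar> powr \<alpha> * (\<tau> (Suc i) - \<tau> i)))"
    using \<tau> by (intro sum_ennreal[symmetric] mult_nonneg_nonneg) auto
  also have "\<dots> = (\<Sum>i<m. \<integral>\<^sup>+s. ennreal (\<bar>\<xi> i \<omega>\<bar> powr \<alpha>) * indicator {\<tau> i<..\<tau> (Suc i)} s \<partial>lborel)"
    using \<tau> by (intro sum.cong) (auto simp: nn_integral_cmult_indicator ennreal_mult)
  also have "\<dots> = (\<integral>\<^sup>+s. (\<Sum>i<m. ennreal (\<bar>\<xi> i \<omega>\<bar> powr \<alpha>) * indicator {\<tau> i<..\<tau> (Suc i)} s) \<partial>lborel)"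
    by (rule nn_integral_sum[symmetric]) auto
  also have "\<dots> \<le> (\<integral>\<^sup>+s\<in>{0<..T}. ennreal (\<bar>simple_process m \<tau> \<xi> s \<omega>\<bar> powr \<alpha>) \<partial>lborel)"
  proof (rule nn_integral_mono)
    fix s
    show "(\<Sum>i<m. ennreal (\<bar>\<xi> i \<omega>\<bar> powr \<alpha>) * indicator {\<tau> i<..\<tau> (Suc i)} s) \<le>
        ennreal (\<bar>simple_process m \<tau> \<xi> s \<omega>\<bar> powr \<alpha>) * indicator {0<..T} s"
    proof (cases "\<exists>i<m. s \<in> {\<tau> i<..\<tau> (Suc i)}")
      case True
      then obtain i where i: "i < m" "s \<in> {\<tau> i<..\<tau> (Suc i)}" by blast
      have uniq: "s \<in> {\<tau> j<..\<tau> (Suc j)} \<longleftrightarrow> j = i" if "j < m" for j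
      proof
        assume j: "s \<in> {\<tau> j<..\<tau> (Suc j)}"
        have "\<not> j < i" using \<tau>[of "Suc j" i] i j by auto
        moreover have "\<not> i < j" using \<tau>[of "Suc i" j] i j that by auto
        ultimately show "j = i" by simp
      qed (use i in auto)
      have "(\<Sum>j<m. ennreal (\<bar>\<xi> j \<omega>\<bar> powr \<alpha>) * indicator {\<tau> j<..\<tau> (Suc j)} s) =
          (\<Sum>j<m. if j = i then ennreal (\<bar>\<xi> j \<omega>\<bar> powr \<alpha>) else 0)"
        using uniq by (intro sum.cong) (auto simp: indicator_def)
      moreover have "simple_process m \<tau> \<xi> s \<omega> = (\<Sum>j<m. if j = i then \<xi> j \<omega> else 0)"
        unfolding simple_process_def using uniq by (intro sum.cong) (auto simp: indicator_def)
      moreover have "s \<in> {0<..T}"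
        using i T \<tau>[of 0 i] \<tau>[of "Suc i" m] by auto
      ultimately show ?thesis using i by simp
    next
      case False
      then show ?thesis by (intro sum_nonpos[THEN order_trans]) (auto simp: indicator_def)
    qed
  qed
  finally show ?thesis .
qed

definition dyadic_above :: "real \<Rightarrow> nat \<Rightarrow> real \<Rightarrow> real" where
  "dyadic_above T n s = min T ((of_int \<lfloor>s * 2 ^ n / T\<rfloor> + 1) * (T / 2 ^ n))"

lemma dyadic_above_bounds:
  assumes "0 < T" "s \<le> T"
  shows "s \<le> dyadic_above T n s" "dyadic_above T n s \<le> s + T / 2 ^ n"
    "dyadic_above T n s \<le> T" "s < T \<Longrightarrow> s < dyadic_above T n s"
proof -
  have 1: "s = (s * 2 ^ n / T) * (T / 2 ^ n)" using assms by simp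
  have "s * 2 ^ n / T < of_int \<lfloor>s * 2 ^ n / T\<rfloor> + 1" by linarith
  then have "(s * 2 ^ n / T) * (T / 2 ^ n) < (of_int \<lfloor>s * 2 ^ n / T\<rfloor> + 1) * (T / 2 ^ n)"
    using assms by (intro mult_strict_right_mono) auto
  then have 2: "s < (of_int \<lfloor>s * 2 ^ n / T\<rfloor> + 1) * (T / 2 ^ n)" using 1 by linarith
  have "(of_int \<lfloor>s * 2 ^ n / T\<rfloor> + 1) * (T / 2 ^ n) \<le> (s * 2 ^ n / T + 1) * (T / 2 ^ n)"
    using assms by (intro mult_right_mono) auto
  also have "\<dots> = s + T / 2 ^ n" using assms by (simp add: distrib_right add_divide_distrib)
  finally have 3: "(of_int \<lfloor>s * 2 ^ n / T\<rfloor> + 1) * (T / 2 ^ n) \<le> s + T / 2 ^ n" .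
  show "s \<le> dyadic_above T n s" "dyadic_above T n s \<le> s + T / 2 ^ n"
    "dyadic_above T n s \<le> T" "s < T \<Longrightarrow> s < dyadic_above T n s"
    using 2 3 assms unfolding dyadic_above_def by linarith+
qed

lemma dyadic_above_grid:
  assumes "0 < T" "0 \<le> s" "s \<le> T"
  shows "\<exists>j\<le>2 ^ n. dyadic_above T n s = real j * T / 2 ^ n"
proof (cases "(of_int \<lfloor>s * 2 ^ n / T\<rfloor> + 1) * (T / 2 ^ n) \<le> T")
  case True
  define j where "j = nat (\<lfloor>s * 2 ^ n / T\<rfloor> + 1)"
  have "0 \<le> \<lfloor>s * 2 ^ n / T\<rfloor>" using assms by auto
  then have j: "real j = of_int \<lfloor>s * 2 ^ n / T\<rfloor> + 1" by (simp add: j_def)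
  have "real j \<le> 2 ^ n"
    using True assms unfolding j[symmetric] by (simp add: field_simps)
  then have "j \<le> 2 ^ n" by (metis of_nat_le_iff of_nat_numeral of_nat_power)
  moreover have "dyadic_above T n s = real j * T / 2 ^ n"
    using True unfolding dyadic_above_def j[symmetric] by simp
  ultimately show ?thesis by blast
next
  case False
  then show ?thesis by (intro exI[of _ "2 ^ n"]) (auto simp: dyadic_above_def)
qed

lemma cadlag_dyadic_tendsto:
  assumes f: "cadlag_on I f" and I: "{0..T} \<subseteq> I" and T: "0 < T" and s: "s \<in> {0..T}"
  shows "(\<lambda>n. f (dyadic_above T n s)) \<longlonglongrightarrow> f s"
proof (cases "s = T")
  case True
  then have "dyadic_above T n s = s" for n
    using dyadic_above_bounds(1,3)[OF T, of s n] by auto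
  then show ?thesis by simp
next
  case False
  then have sT: "s < T" using s by simp
  have lim: "(\<lambda>n. s + T / 2 ^ n) \<longlonglongrightarrow> s + 0"
    by (intro tendsto_add tendsto_const LIMSEQ_divide_realpow_zero) simp
  have "(\<lambda>n. dyadic_above T n s) \<longlonglongrightarrow> s"
  proof (rule tendsto_sandwich[where f = "\<lambda>_. s" and h = "\<lambda>n. s + T / 2 ^ n"])
    show "(\<lambda>n. s + T / 2 ^ n) \<longlonglongrightarrow> s" using lim by simp
    show "\<forall>\<^sub>F n in sequentially. s \<le> dyadic_above T n s"
      "\<forall>\<^sub>F n in sequentially. dyadic_above T n s \<le> s + T / 2 ^ n"
      using dyadic_above_bounds(1,2)[OF T] sT by (simp_all add: less_imp_le)
  qed simp
  moreover have "dyadic_above T n s \<in> I \<inter> {s<..}" "dyadic_above T n s \<noteq> s" for n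
  proof -
    have "dyadic_above T n s \<in> {0..T} \<inter> {s<..}"
      using dyadic_above_bounds[OF T, of s n] sT s by auto
    then show "dyadic_above T n s \<in> I \<inter> {s<..}" "dyadic_above T n s \<noteq> s"
      using I by auto
  qed
  ultimately have "filterlim (\<lambda>n. dyadic_above T n s) (at s within I \<inter> {s<..}) sequentially"
    by (simp add: filterlim_at)
  moreover have "(f \<longlongrightarrow> f s) (at s within I \<inter> {s<..})"
    using f s I unfolding cadlag_on_def by blast
  ultimately show ?thesis by (rule filterlim_compose[rotated])
qed

context stable_noise begin

lemma simple_integral_moment:
  assumes sp: "simple_predictable M F T m \<tau> \<xi>" and R: "0 < R"
    and le: "\<And>\<omega>. \<omega> \<in> space M \<Longrightarrow> (\<Sum>i<m. \<bar>\<xi> i \<omega>\<bar> powr \<alpha> * (\<tau> (Suc i) - \<tau> i)) \<le> R"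
  shows "(\<integral>\<^sup>+\<omega>. ennreal \<bar>simple_integral Z m \<tau> \<xi> \<omega>\<bar> \<partial>M) \<le>
    ennreal (moment_const \<alpha> * (char_const \<alpha> * R) powr (1 / \<alpha>))"
proof (rule abs_moment_le_char)
  show "norm ((\<integral>\<omega>. iexp (u * simple_integral Z m \<tau> \<xi> \<omega>) \<partial>M) - 1) \<le> char_const \<alpha> * R * u powr \<alpha>"
    if "0 < u" for u
    using simple_integral_char_bound[OF sp le, of u] that by (simp add: mult_ac)
  show "0 < char_const \<alpha> * R" using R char_const_ge_1[of \<alpha>] by simp
qed (use simple_integral_measurable[OF sp] alpha in auto)

text \<open>Stopping the grid walk at the first time it exceeds \<open>r\<close> is a simple integral.\<close>

lemma maximal_inequality_grid:
  assumes T: "0 < T" and r: "0 < r" and m: "0 < m"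
  shows "emeasure M {\<omega>\<in>space M. \<exists>j\<le>m. r < \<bar>Z (real j * T / real m) \<omega> - Z 0 \<omega>\<bar>} \<le>
    ennreal (moment_const \<alpha> * (char_const \<alpha> * T) powr (1 / \<alpha>) / r)"
proof -
  define \<tau> where "\<tau> i = real i * T / real m" for i
  define \<xi> where "\<xi> i \<omega> = (if \<forall>j\<le>i. \<bar>Z (\<tau> j) \<omega> - Z 0 \<omega>\<bar> \<le> r then 1 else 0 :: real)" for i \<omega>
  have \<tau>0: "0 \<le> \<tau> i" for i using T by (simp add: \<tau>_def)
  have \<tau>mono: "\<tau> i \<le> \<tau> j" if "i \<le> j" for i j
    using T that by (auto simp: \<tau>_def intro!: divide_right_mono mult_right_mono)
  have \<tau>m: "\<tau> m = T" using m by (simp add: \<tau>_def)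
  have sp: "simple_predictable M F T m \<tau> \<xi>"
    unfolding simple_predictable_def
  proof (intro conjI allI impI)
    fix i
    show "bounded (\<xi> i ` space M)"
      by (rule boundedI[where B = 1]) (auto simp: \<xi>_def)
    have Zm: "Z (\<tau> j) \<in> borel_measurable (F (\<tau> i))" if "j \<le> i" for j
      by (rule measurable_F_mono[OF Z_adapted[OF \<tau>0]]) (use that \<tau>mono in auto)
    have Z0: "Z 0 \<in> borel_measurable (F (\<tau> i))"
      using Zm[of 0] by (simp add: \<tau>_def)
    have "Measurable.pred (F (\<tau> i)) (\<lambda>\<omega>. \<forall>j\<in>{..i}. \<bar>Z (\<tau> j) \<omega> - Z 0 \<omega>\<bar> \<le> r)"
      using Zm Z0 by (intro pred_intros_finite) (auto intro!: borel_measurable_le)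
    then have "Measurable.pred (F (\<tau> i)) (\<lambda>\<omega>. \<forall>j\<le>i. \<bar>Z (\<tau> j) \<omega> - Z 0 \<omega>\<bar> \<le> r)"
      by (simp only: Ball_def atMost_iff)
    then show "\<xi> i \<in> borel_measurable (F (\<tau> i))"
      unfolding \<xi>_def[abs_def] by measurable
  qed (use \<tau>0 \<tau>mono \<tau>m in auto)
  have le: "(\<Sum>i<m. \<bar>\<xi> i \<omega>\<bar> powr \<alpha> * (\<tau> (Suc i) - \<tau> i)) \<le> T" for \<omega>
  proof -
    have "(\<Sum>i<m. \<bar>\<xi> i \<omega>\<bar> powr \<alpha> * (\<tau> (Suc i) - \<tau> i)) \<le> (\<Sum>i<m. \<tau> (Suc i) - \<tau> i)"
      using \<tau>mono by (intro sum_mono mult_left_le_one_le) (auto simp: \<xi>_def)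
    also have "\<dots> = T" unfolding sum_lessThan_telescope \<tau>m by (simp add: \<tau>_def)
    finally show ?thesis .
  qed
  let ?S = "simple_integral Z m \<tau> \<xi>"
  note [measurable] = simple_integral_measurable[OF sp]
  have "r \<le> \<bar>?S \<omega>\<bar>" if j: "j \<le> m" "r < \<bar>Z (\<tau> j) \<omega> - Z 0 \<omega>\<bar>" for j \<omega>
  proof -
    define n where "n = (LEAST j. r < \<bar>Z (\<tau> j) \<omega> - Z 0 \<omega>\<bar>)"
    have n: "r < \<bar>Z (\<tau> n) \<omega> - Z 0 \<omega>\<bar>" unfolding n_def using j(2) by (rule LeastI)
    have nm: "n \<le> m" using Least_le[of "\<lambda>j. r < \<bar>Z (\<tau> j) \<omega> - Z 0 \<omega>\<bar>", OF j(2)] j by (simp add: n_def)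
    have less: "\<bar>Z (\<tau> i) \<omega> - Z 0 \<omega>\<bar> \<le> r" if "i < n" for i
      using not_less_Least[of i] that by (force simp: n_def)
    have "?S \<omega> = (\<Sum>i<m. if i < n then Z (\<tau> (Suc i)) \<omega> - Z (\<tau> i) \<omega> else 0)"
      unfolding simple_integral_def
    proof (rule sum.cong)
      fix i
      have "\<xi> i \<omega> = (if i < n then 1 else 0)"
        using less n by (auto simp: \<xi>_def not_less)
      then show "\<xi> i \<omega> * (Z (\<tau> (Suc i)) \<omega> - Z (\<tau> i) \<omega>) =
          (if i < n then Z (\<tau> (Suc i)) \<omega> - Z (\<tau> i) \<omega> else 0)" by simp
    qed simp
    also have "\<dots> = (\<Sum>i<n. Z (\<tau> (Suc i)) \<omega> - Z (\<tau> i) \<omega>)"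
      using nm by (intro sum.mono_neutral_cong_right) auto
    also have "\<dots> = Z (\<tau> n) \<omega> - Z (\<tau> 0) \<omega>"
      by (rule sum_lessThan_telescope)
    also have "\<tau> 0 = 0" by (simp add: \<tau>_def)
    finally show ?thesis using n by simp
  qed
  then have "emeasure M {\<omega>\<in>space M. \<exists>j\<le>m. r < \<bar>Z (\<tau> j) \<omega> - Z 0 \<omega>\<bar>} \<le>
      emeasure M {\<omega>\<in>space M. 1 \<le> ennreal (1 / r) * ennreal \<bar>?S \<omega>\<bar>}"
    using r by (intro emeasure_mono) (auto simp: ennreal_mult[symmetric] simp flip: ennreal_1)
  also have "\<dots> \<le> ennreal (1 / r) * (\<integral>\<^sup>+\<omega>. ennreal \<bar>?S \<omega>\<bar> * indicator (space M) \<omega> \<partial>M)"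
    by (rule nn_integral_Markov_inequality) auto
  also have "(\<integral>\<^sup>+\<omega>. ennreal \<bar>?S \<omega>\<bar> * indicator (space M) \<omega> \<partial>M) = (\<integral>\<^sup>+\<omega>. ennreal \<bar>?S \<omega>\<bar> \<partial>M)"
    by (intro nn_integral_cong) auto
  also have "ennreal (1 / r) * \<dots> \<le>
      ennreal (1 / r) * ennreal (moment_const \<alpha> * (char_const \<alpha> * T) powr (1 / \<alpha>))"
    by (intro mult_left_mono simple_integral_moment[OF sp T le]) auto
  also have "\<dots> = ennreal (moment_const \<alpha> * (char_const \<alpha> * T) powr (1 / \<alpha>) / r)"
    using r moment_const_nonneg[OF alpha] by (simp add: ennreal_mult[symmetric])
  finally show ?thesis by (simp add: \<tau>_def)
qed

lemma maximal_inequality: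
  assumes T: "0 < T" and r: "0 < r"
  obtains N where "N \<in> sets M"
    "emeasure M N \<le> ennreal (moment_const \<alpha> * (char_const \<alpha> * T) powr (1 / \<alpha>) / r)"
    "\<And>\<omega> s. \<omega> \<in> space M - N \<Longrightarrow> s \<in> {0..T} \<Longrightarrow> \<bar>Z s \<omega>\<bar> \<le> r"
proof
  define E where "E n = {\<omega>\<in>space M. \<exists>j\<le>2 ^ n. r < \<bar>Z (real j * T / 2 ^ n) \<omega> - Z 0 \<omega>\<bar>}" for n :: nat
  define N where "N = (\<Union>n. E n) \<union> {\<omega>\<in>space M. Z 0 \<omega> \<noteq> 0}"
  have [measurable]: "Z (real j * T / 2 ^ n) \<in> borel_measurable M" for j n :: nat
    using T by (intro Z_measurable) simp
  have [measurable]: "Z 0 \<in> borel_measurable M" by (rule Z_measurable) simp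
  have E [measurable]: "E n \<in> sets M" for n unfolding E_def by measurable
  have "AE \<omega> in M. Z 0 \<omega> = 0" using noise by (simp add: stable_levy_process_def)
  then have null: "emeasure M {\<omega>\<in>space M. Z 0 \<omega> \<noteq> 0} = 0"
    by (subst (asm) AE_iff_measurable[OF _ refl]) auto
  show "N \<in> sets M" unfolding N_def by measurable
  have "incseq E"
  proof (rule incseq_SucI)
    fix n
    show "E n \<le> E (Suc n)"
    proof
      fix \<omega> assume "\<omega> \<in> E n"
      then obtain j where j: "\<omega> \<in> space M" "j \<le> 2 ^ n" "r < \<bar>Z (real j * T / 2 ^ n) \<omega> - Z 0 \<omega>\<bar>"
        by (auto simp: E_def)
      have "real j * T / 2 ^ n = real (2 * j) * T / 2 ^ Suc n" by simp
      with j(3) have "r < \<bar>Z (real (2 * j) * T / 2 ^ Suc n) \<omega> - Z 0 \<omega>\<bar>" by (simp only:)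
      moreover have "2 * j \<le> 2 ^ Suc n" using j(2) by simp
      ultimately show "\<omega> \<in> E (Suc n)" using j(1) unfolding E_def by blast
    qed
  qed
  then have "emeasure M (\<Union>n. E n) = (SUP n. emeasure M (E n))"
    by (intro SUP_emeasure_incseq[symmetric]) auto
  also have "\<dots> \<le> ennreal (moment_const \<alpha> * (char_const \<alpha> * T) powr (1 / \<alpha>) / r)"
    using maximal_inequality_grid[OF T r, of "2 ^ n" for n] by (intro SUP_least) (auto simp: E_def)
  finally show "emeasure M N \<le> ennreal (moment_const \<alpha> * (char_const \<alpha> * T) powr (1 / \<alpha>) / r)"
    unfolding N_def by (subst emeasure_Un_null_set) (auto simp: null_sets_def null)
  fix \<omega> s assume \<omega>: "\<omega> \<in> space M - N" and s: "s \<in> {0..T}"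
  have grid: "\<bar>Z (dyadic_above T n s) \<omega>\<bar> \<le> r" for n
    using dyadic_above_grid[of T s n] T s \<omega> by (force simp: N_def E_def)
  have "cadlag_on {0..} (\<lambda>t. Z t \<omega>)" using noise \<omega> by (auto simp: stable_levy_process_def)
  then have "(\<lambda>n. Z (dyadic_above T n s) \<omega>) \<longlonglongrightarrow> Z s \<omega>"
    by (rule cadlag_dyadic_tendsto) (use T s in auto)
  then have "(\<lambda>n. \<bar>Z (dyadic_above T n s) \<omega>\<bar>) \<longlonglongrightarrow> \<bar>Z s \<omega>\<bar>" by (rule tendsto_rabs)
  then show "\<bar>Z s \<omega>\<bar> \<le> r" by (rule LIMSEQ_le_const2) (use grid in auto)
qed

end

text \<open>\<^const>\<open>measure\<close> is zero on nonmeasurable sets, so the convergence in probability required by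
  \<^const>\<open>has_stable_integral\<close> is informative only because predictability gives joint
  measurability.\<close>

lemma predictable_joint_measurable:
  assumes sub: "\<And>t. sets (F t) \<subseteq> sets M" and H: "predictable M F T H"
  shows "(\<lambda>(\<omega>, s). H s \<omega> * indicator {0<..T} s) \<in> borel_measurable (M \<Otimes>\<^sub>M (lborel :: real measure))"
proof -
  let ?R = "restrict_space (M \<Otimes>\<^sub>M (lborel :: real measure)) (space M \<times> {0<..T})"
  have sets: "space M \<times> {0<..T} \<in> sets (M \<Otimes>\<^sub>M (lborel :: real measure))"
    by (intro pair_measureI) auto
  have "(\<lambda>(\<omega>, s). (s, \<omega>)) \<in> measurable ?R (predictable_sigma (space M) F T)"
    unfolding predictable_sigma_def
  proof (rule measurable_measure_of)
    show "{{s<..t} \<times> A |s t A. 0 \<le> s \<and> s \<le> t \<and> t \<le> T \<and> A \<in> sets (F s)} \<subseteq> Pow ({0<..T} \<times> space M)"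
      using sub sets.sets_into_space[of _ M] by fastforce
    show "(\<lambda>(\<omega>, s). (s, \<omega>)) \<in> space ?R \<rightarrow> {0<..T} \<times> space M"
      by (auto simp: space_restrict_space)
    fix y assume "y \<in> {{s<..t} \<times> A |s t A. 0 \<le> s \<and> s \<le> t \<and> t \<le> T \<and> A \<in> sets (F s)}"
    then obtain s t A where y: "y = {s<..t} \<times> A" "0 \<le> s" "s \<le> t" "t \<le> T" "A \<in> sets (F s)" by blast
    then have A: "A \<in> sets M" using sub by blast
    have "(\<lambda>(\<omega>, s). (s, \<omega>)) -` y \<inter> space ?R = A \<times> {s<..t}"
      using y sets.sets_into_space[OF A] by (auto simp: space_restrict_space space_pair_measure)
    moreover have "A \<times> {s<..t} \<in> sets (M \<Otimes>\<^sub>M (lborel :: real measure))"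
      using A by (intro pair_measureI) auto
    moreover have "A \<times> {s<..t} \<subseteq> space M \<times> {0<..T}"
      using y sets.sets_into_space[OF A] by auto
    ultimately show "(\<lambda>(\<omega>, s). (s, \<omega>)) -` y \<inter> space ?R \<in> sets ?R"
      using sets by (simp add: sets_restrict_space_iff)
  qed
  from measurable_compose[OF this H[unfolded predictable_def]]
  have "(\<lambda>p. H (snd p) (fst p)) \<in> borel_measurable ?R"
    by (simp add: case_prod_beta)
  then have "(\<lambda>p. indicator (space M \<times> {0<..T}) p *\<^sub>R H (snd p) (fst p)) \<in>
      borel_measurable (M \<Otimes>\<^sub>M (lborel :: real measure))"
    using sets by (subst (asm) borel_measurable_restrict_space_iff) (auto simp: space_pair_measure)
  then show ?thesis
    by (rule measurable_cong[THEN iffD1, rotated])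
       (auto simp: space_pair_measure indicator_def)
qed

lemma norm_iexp_diff_le: "norm (iexp x - iexp y) \<le> \<bar>x - y\<bar>"
proof -
  have "norm (iexp x - iexp y) = norm (iexp y * (iexp (x - y) - 1))"
    by (simp add: right_diff_distrib mult_exp_exp flip: distrib_left)
  also have "\<dots> \<le> norm (\<i> * complex_of_real (x - y))"
    unfolding norm_mult[of "iexp y"] using norm_exp_diff_one_le[of "\<i> * complex_of_real (x - y)"]
    by (simp del: of_real_diff)
  finally show ?thesis by (simp add: norm_mult del: of_real_diff)
qed

context stable_noise begin

text \<open>Setting the approximating simple integrands to zero once their accumulated
  \<open>\<alpha>\<close>-energy exceeds a constant keeps them adapted and changes them only on an event
  whose probability tends to zero.\<close>

lemma stable_integral_char_bound:
  assumes J: "has_stable_integral M F Z \<alpha> T H J"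
    and h [measurable]: "h \<in> borel_measurable borel" and h0: "\<And>s. 0 \<le> h s"
    and bound: "AE \<omega> in M. AE s in lborel. 0 < s \<and> s \<le> T \<longrightarrow> \<bar>H s \<omega>\<bar> \<le> h s"
    and R: "(\<integral>\<^sup>+s\<in>{0<..T}. ennreal (h s powr \<alpha>) \<partial>lborel) \<le> ennreal R" "0 < R"
  shows "norm ((\<integral>\<omega>. iexp (u * J \<omega>) \<partial>M) - 1) \<le>
    char_const \<alpha> * \<bar>u\<bar> powr \<alpha> * (2 powr \<alpha> * (2 * R))"
proof (rule field_le_epsilon)
  fix \<epsilon> :: real assume "0 < \<epsilon>"
  define \<eta> where "\<eta> = \<epsilon> / 5"
  have \<eta>: "0 < \<eta>" using \<open>0 < \<epsilon>\<close> by (simp add: \<eta>_def)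
  define e where "e = \<eta> / (\<bar>u\<bar> + 1)"
  have e: "0 < e" "\<bar>u\<bar> * e \<le> \<eta>"
    using \<eta> by (auto simp: e_def field_simps)
  define Q where "Q = 2 powr \<alpha> * (2 * R)"
  have Q: "0 < Q" using R by (simp add: Q_def)
  have pred: "predictable M F T H" and Jm [measurable]: "J \<in> borel_measurable M"
    using J by (auto simp: has_stable_integral_def)
  obtain m \<tau> \<xi> where
    sp: "\<And>n. simple_predictable M F T (m n) (\<tau> n) (\<xi> n)"
    and lim1: "\<And>e. 0 < e \<Longrightarrow>
      (\<lambda>n. measure M {\<omega>\<in>space M. ennreal e <
             (\<integral>\<^sup>+s\<in>{0<..T}. ennreal (\<bar>simple_process (m n) (\<tau> n) (\<xi> n) s \<omega> - H s \<omega>\<bar> powr \<alpha>) \<partial>lborel)})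
           \<longlonglongrightarrow> 0"
    and lim2: "\<And>e. 0 < e \<Longrightarrow> (\<lambda>n. measure M {\<omega>\<in>space M.
             e < \<bar>simple_integral Z (m n) (\<tau> n) (\<xi> n) \<omega> - J \<omega>\<bar>}) \<longlonglongrightarrow> 0"
    using J unfolding has_stable_integral_def by blast
  define B1 where "B1 n = {\<omega>\<in>space M. ennreal R <
      (\<integral>\<^sup>+s\<in>{0<..T}. ennreal (\<bar>simple_process (m n) (\<tau> n) (\<xi> n) s \<omega> - H s \<omega>\<bar> powr \<alpha>) \<partial>lborel)}" for n
  define B2 where "B2 n = {\<omega>\<in>space M. e < \<bar>simple_integral Z (m n) (\<tau> n) (\<xi> n) \<omega> - J \<omega>\<bar>}" for n
  have "\<forall>\<^sub>F n in sequentially. measure M (B1 n) < \<eta> \<and> measure M (B2 n) < \<eta>"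
    using order_tendstoD(2)[OF lim1[OF R(2)] \<eta>] order_tendstoD(2)[OF lim2[OF e(1)] \<eta>]
    unfolding B1_def B2_def by (rule eventually_conj)
  then obtain n where n: "measure M (B1 n) < \<eta>" "measure M (B2 n) < \<eta>"
    using eventually_happens'[OF sequentially_bot] by blast
  define m' where "m' = m n"
  define t where "t = \<tau> n"
  define x where "x = \<xi> n"
  note sp = sp[of n, folded m'_def t_def x_def]
  have t_mono: "t i \<le> t j" if "i \<le> j" "j \<le> m'" for i j
    using simple_predictable_times_mono[OF sp that] .
  have tT: "0 \<le> t 0" "t m' \<le> T" using sp by (auto simp: simple_predictable_def)
  have x_F: "x i \<in> borel_measurable (F (t i))" if "i < m'" for i
    using sp that by (auto simp: simple_predictable_def)
  have x_M [measurable]: "x i \<in> borel_measurable M" if "i < m'" for i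
    using measurable_F_M[OF x_F[OF that]] .
  define a where "a i \<omega> = \<bar>x i \<omega>\<bar> powr \<alpha> * (t (Suc i) - t i)" for i \<omega>
  have a0: "0 \<le> a i \<omega>" if "i < m'" for i \<omega>
    using t_mono[of i "Suc i"] that by (simp add: a_def)
  define y where "y i \<omega> = (if (\<Sum>j<Suc i. a j \<omega>) \<le> Q then x i \<omega> else 0)" for i \<omega>
  have spy: "simple_predictable M F T m' t y"
    unfolding simple_predictable_def
  proof (intro conjI allI impI tT)
    fix i assume i: "i < m'"
    show "t i \<le> t (Suc i)" using t_mono i by simp
    have "x j \<in> borel_measurable (F (t i))" if "j \<le> i" for j
      using that i by (intro measurable_F_mono[OF x_F t_mono]) auto
    then have "(\<lambda>\<omega>. \<Sum>j<Suc i. a j \<omega>) \<in> borel_measurable (F (t i))"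
      unfolding a_def by (intro borel_measurable_sum borel_measurable_times borel_measurable_const
          powr_real_measurable borel_measurable_abs) auto
    then show "y i \<in> borel_measurable (F (t i))"
      unfolding y_def[abs_def] using x_F[OF i] by measurable
    obtain b where b: "\<And>\<omega>. \<omega> \<in> space M \<Longrightarrow> \<bar>x i \<omega>\<bar> \<le> b"
      using sp i unfolding simple_predictable_def bounded_iff real_norm_def by fast
    show "bounded (y i ` space M)"
      using b by (intro boundedI[where B = "\<bar>b\<bar>"]) (force simp: y_def)
  qed
  have sum_y: "(\<Sum>i<m'. \<bar>y i \<omega>\<bar> powr \<alpha> * (t (Suc i) - t i)) \<le> Q" for \<omega>
  proof -
    have "(\<Sum>i<m'. \<bar>y i \<omega>\<bar> powr \<alpha> * (t (Suc i) - t i)) =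
        (\<Sum>i<m'. if (\<Sum>j<Suc i. a j \<omega>) \<le> Q then a i \<omega> else 0)"
      by (intro sum.cong) (auto simp: y_def a_def)
    also have "\<dots> \<le> Q" using a0 Q by (intro sum_stopped_le) auto
    finally show ?thesis .
  qed
  let ?S = "simple_integral Z m' t x" and ?S' = "simple_integral Z m' t y"
  note [measurable] = simple_integral_measurable[OF sp] simple_integral_measurable[OF spy]
  have B2 [measurable]: "B2 n \<in> sets M"
    unfolding B2_def m'_def[symmetric] t_def[symmetric] x_def[symmetric] by measurable
  have B1 [measurable]: "B1 n \<in> sets M"
  proof -
    note Hm = predictable_joint_measurable[OF sets_F_le pred]
    have xm: "(\<lambda>p. x i (fst p) * indicat_real {t i<..t (Suc i)} (snd p)) \<in>
        borel_measurable (M \<Otimes>\<^sub>M (lborel :: real measure))" if "i < m'" for i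
      using x_M[OF that] by measurable
    have "(\<lambda>p. simple_process m' t x (snd p) (fst p)) \<in> borel_measurable (M \<Otimes>\<^sub>M (lborel :: real measure))"
      unfolding simple_process_def using xm by (intro borel_measurable_sum) auto
    then have "(\<lambda>p. ennreal (\<bar>simple_process m' t x (snd p) (fst p) -
        (case p of (\<omega>, s) \<Rightarrow> H s \<omega> * indicator {0<..T} s)\<bar> powr \<alpha>) * indicator {0<..T} (snd p))
        \<in> borel_measurable (M \<Otimes>\<^sub>M (lborel :: real measure))"
      using Hm by measurable
    then have "(\<lambda>(\<omega>, s). ennreal (\<bar>simple_process m' t x s \<omega> - H s \<omega>\<bar> powr \<alpha>) * indicator {0<..T} s)
        \<in> borel_measurable (M \<Otimes>\<^sub>M (lborel :: real measure))"
      by (rule measurable_cong[THEN iffD1, rotated]) (auto simp: indicator_def)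
    from lborel.borel_measurable_nn_integral_fst[OF this]
    have [measurable]: "(\<lambda>\<omega>. \<integral>\<^sup>+s\<in>{0<..T}. ennreal (\<bar>simple_process m' t x s \<omega> - H s \<omega>\<bar> powr \<alpha>) \<partial>lborel)
        \<in> borel_measurable M" by simp
    show ?thesis
      unfolding B1_def m'_def[symmetric] t_def[symmetric] x_def[symmetric] by measurable
  qed
  have same: "AE \<omega> in M. \<omega> \<notin> B1 n \<longrightarrow> ?S' \<omega> = ?S \<omega>"
    using bound
  proof (rule AE_mp, intro AE_I2 impI)
    fix \<omega> assume \<omega>: "\<omega> \<in> space M" "\<omega> \<notin> B1 n"
      and b: "AE s in lborel. 0 < s \<and> s \<le> T \<longrightarrow> \<bar>H s \<omega>\<bar> \<le> h s"
    let ?p = "\<lambda>s. simple_process m' t x s \<omega>"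
    have pm [measurable]: "?p \<in> borel_measurable borel"
      unfolding simple_process_def by measurable
    define f where "f s = max 0 (\<bar>?p s\<bar> powr \<alpha> / 2 powr \<alpha> - h s powr \<alpha>)" for s
    have [measurable]: "f \<in> borel_measurable borel" unfolding f_def by measurable
    have "(\<integral>\<^sup>+s\<in>{0<..T}. ennreal (f s) \<partial>lborel) \<le>
        (\<integral>\<^sup>+s\<in>{0<..T}. ennreal (\<bar>?p s - H s \<omega>\<bar> powr \<alpha>) \<partial>lborel)"
    proof (rule nn_integral_mono_AE)
      show "AE s in lborel. ennreal (f s) * indicator {0<..T} s \<le>
          ennreal (\<bar>?p s - H s \<omega>\<bar> powr \<alpha>) * indicator {0<..T} s"
        using b
      proof (rule AE_mp, intro AE_I2 impI)
        fix s assume s: "0 < s \<and> s \<le> T \<longrightarrow> \<bar>H s \<omega>\<bar> \<le> h s"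
        show "ennreal (f s) * indicator {0<..T} s \<le>
          ennreal (\<bar>?p s - H s \<omega>\<bar> powr \<alpha>) * indicator {0<..T} s"
        proof (cases "s \<in> {0<..T}")
          case True
          then have "\<bar>?p s\<bar> powr \<alpha> \<le> 2 powr \<alpha> * (\<bar>?p s - H s \<omega>\<bar> powr \<alpha> + h s powr \<alpha>)"
            using s alpha by (intro powr_le_quasi_triangle) auto
          then have "\<bar>?p s\<bar> powr \<alpha> / 2 powr \<alpha> \<le> \<bar>?p s - H s \<omega>\<bar> powr \<alpha> + h s powr \<alpha>"
            by (subst pos_divide_le_eq) (auto simp: mult.commute)
          then have "f s \<le> \<bar>?p s - H s \<omega>\<bar> powr \<alpha>" by (simp add: f_def)
          then show ?thesis using True by (simp add: ennreal_leI)
        qed simp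
      qed
    qed
    also have "\<dots> \<le> ennreal R"
      using \<omega> by (simp add: B1_def m'_def t_def x_def not_less)
    finally have fR: "(\<integral>\<^sup>+s\<in>{0<..T}. ennreal (f s) \<partial>lborel) \<le> ennreal R" .
    have "ennreal (\<Sum>i<m'. a i \<omega>) \<le> (\<integral>\<^sup>+s\<in>{0<..T}. ennreal (\<bar>?p s\<bar> powr \<alpha>) \<partial>lborel)"
      unfolding a_def using t_mono tT by (rule simple_process_nn_integral_ge)
    also have "\<dots> \<le> (\<integral>\<^sup>+s. ennreal (2 powr \<alpha>) * (ennreal (f s) * indicator {0<..T} s +
        ennreal (h s powr \<alpha>) * indicator {0<..T} s) \<partial>lborel)"
    proof (rule nn_integral_mono)
      fix s
      have "\<bar>?p s\<bar> powr \<alpha> / 2 powr \<alpha> \<le> f s + h s powr \<alpha>" by (simp add: f_def)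
      then have "\<bar>?p s\<bar> powr \<alpha> \<le> 2 powr \<alpha> * (f s + h s powr \<alpha>)"
        by (subst (asm) pos_divide_le_eq) (auto simp: mult.commute)
      then have "ennreal (\<bar>?p s\<bar> powr \<alpha>) \<le> ennreal (2 powr \<alpha> * (f s + h s powr \<alpha>))"
        by (rule ennreal_leI)
      also have "0 \<le> f s" by (simp add: f_def)
      then have "ennreal (2 powr \<alpha> * (f s + h s powr \<alpha>)) =
          ennreal (2 powr \<alpha>) * (ennreal (f s) + ennreal (h s powr \<alpha>))"
        by (simp add: ennreal_mult' ennreal_plus)
      finally have "ennreal (\<bar>?p s\<bar> powr \<alpha>) \<le> ennreal (2 powr \<alpha>) * (ennreal (f s) + ennreal (h s powr \<alpha>))" .
      then show "ennreal (\<bar>?p s\<bar> powr \<alpha>) * indicator {0<..T} s \<le>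
          ennreal (2 powr \<alpha>) * (ennreal (f s) * indicator {0<..T} s +
          ennreal (h s powr \<alpha>) * indicator {0<..T} s)"
        by (auto simp: indicator_def)
    qed
    also have "\<dots> = ennreal (2 powr \<alpha>) * ((\<integral>\<^sup>+s\<in>{0<..T}. ennreal (f s) \<partial>lborel) +
        (\<integral>\<^sup>+s\<in>{0<..T}. ennreal (h s powr \<alpha>) \<partial>lborel))"
      by (simp add: nn_integral_cmult nn_integral_add)
    also have "\<dots> \<le> ennreal (2 powr \<alpha>) * (ennreal R + ennreal R)"
      by (intro mult_left_mono add_mono fR R) auto
    also have "\<dots> = ennreal Q"
      using R by (simp add: Q_def ennreal_mult'[symmetric] flip: ennreal_plus)
    finally have aQ: "(\<Sum>i<m'. a i \<omega>) \<le> Q"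
      using Q by (simp add: ennreal_le_iff)
    have "y i \<omega> = x i \<omega>" if "i < m'" for i
    proof -
      have "(\<Sum>j<Suc i. a j \<omega>) \<le> (\<Sum>j<m'. a j \<omega>)"
        using that a0 by (intro sum_mono2) auto
      then show ?thesis using aQ by (simp add: y_def)
    qed
    then show "?S' \<omega> = ?S \<omega>" unfolding simple_integral_def by (intro sum.cong) auto
  qed
  have int1: "integrable M (\<lambda>\<omega>. iexp (u * J \<omega>))" and int2: "integrable M (\<lambda>\<omega>. iexp (u * ?S' \<omega>))"
    by (auto intro!: integrable_const_bound[where B = 1])
  have "norm ((\<integral>\<omega>. iexp (u * J \<omega>) \<partial>M) - (\<integral>\<omega>. iexp (u * ?S' \<omega>) \<partial>M)) =
      norm (\<integral>\<omega>. iexp (u * J \<omega>) - iexp (u * ?S' \<omega>) \<partial>M)"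
    using int1 int2 by simp
  also have "\<dots> \<le> (\<integral>\<omega>. norm (iexp (u * J \<omega>) - iexp (u * ?S' \<omega>)) \<partial>M)"
    by (rule integral_norm_bound)
  also have "\<dots> \<le> (\<integral>\<omega>. \<eta> + 2 * indicat_real (B1 n) \<omega> + 2 * indicat_real (B2 n) \<omega> \<partial>M)"
  proof (rule integral_mono_AE)
    show "AE \<omega> in M. norm (iexp (u * J \<omega>) - iexp (u * ?S' \<omega>)) \<le>
        \<eta> + 2 * indicat_real (B1 n) \<omega> + 2 * indicat_real (B2 n) \<omega>"
      using same
    proof (rule AE_mp, intro AE_I2 impI)
      fix \<omega> assume \<omega>: "\<omega> \<in> space M" and eq: "\<omega> \<notin> B1 n \<longrightarrow> ?S' \<omega> = ?S \<omega>"
      show "norm (iexp (u * J \<omega>) - iexp (u * ?S' \<omega>)) \<le>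
        \<eta> + 2 * indicat_real (B1 n) \<omega> + 2 * indicat_real (B2 n) \<omega>"
      proof (cases "\<omega> \<in> B1 n \<or> \<omega> \<in> B2 n")
        case True
        have "norm (iexp (u * J \<omega>) - iexp (u * ?S' \<omega>)) \<le> norm (iexp (u * J \<omega>)) + norm (iexp (u * ?S' \<omega>))"
          by (rule norm_triangle_ineq4)
        also have "\<dots> = 2" by (simp del: of_real_mult)
        finally show ?thesis using True \<eta> by (auto simp: indicator_def)
      next
        case False
        have "norm (iexp (u * J \<omega>) - iexp (u * ?S' \<omega>)) \<le> \<bar>u * J \<omega> - u * ?S' \<omega>\<bar>"
          by (rule norm_iexp_diff_le)
        also have "\<dots> = \<bar>u\<bar> * \<bar>?S \<omega> - J \<omega>\<bar>"
          using eq False by (simp add: abs_mult abs_minus_commute flip: right_diff_distrib)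
        also have "\<dots> \<le> \<bar>u\<bar> * e"
          using False \<omega> by (intro mult_left_mono) (auto simp: B2_def m'_def t_def x_def)
        also have "\<dots> \<le> \<eta>" by (rule e)
        finally show ?thesis using False by simp
      qed
    qed
    show "integrable M (\<lambda>\<omega>. \<eta> + 2 * indicat_real (B1 n) \<omega> + 2 * indicat_real (B2 n) \<omega>)"
      using \<eta> by (intro integrable_const_bound[where B = "\<eta> + 4"]) (auto simp: indicator_def)
  qed (use int1 int2 in auto)
  also have "\<dots> = \<eta> + 2 * measure M (B1 n) + 2 * measure M (B2 n)"
  proof -
    have "integrable M (indicat_real (B1 n))" "integrable M (indicat_real (B2 n))"
      by (auto intro!: integrable_const_bound[where B = 1])
    then show ?thesis by (simp add: prob_space)
  qed
  also have "\<dots> \<le> \<epsilon>" using n by (simp add: \<eta>_def)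
  finally have "norm ((\<integral>\<omega>. iexp (u * J \<omega>) \<partial>M) - (\<integral>\<omega>. iexp (u * ?S' \<omega>) \<partial>M)) \<le> \<epsilon>" .
  moreover have "norm ((\<integral>\<omega>. iexp (u * ?S' \<omega>) \<partial>M) - 1) \<le> char_const \<alpha> * \<bar>u\<bar> powr \<alpha> * Q"
    by (rule simple_integral_char_bound[OF spy sum_y])
  ultimately show "norm ((\<integral>\<omega>. iexp (u * J \<omega>) \<partial>M) - 1) \<le>
      char_const \<alpha> * \<bar>u\<bar> powr \<alpha> * (2 powr \<alpha> * (2 * R)) + \<epsilon>"
    using norm_triangle_ineq[of "(\<integral>\<omega>. iexp (u * J \<omega>) \<partial>M) - (\<integral>\<omega>. iexp (u * ?S' \<omega>) \<partial>M)"
      "(\<integral>\<omega>. iexp (u * ?S' \<omega>) \<partial>M) - 1"]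
    by (simp add: Q_def)
qed

definition integral_const :: real where
  "integral_const = moment_const \<alpha> * (char_const \<alpha> * 2 powr \<alpha> * 2) powr (1 / \<alpha>)"

lemma integral_const_nonneg: "0 \<le> integral_const"
  using moment_const_nonneg[OF alpha] by (simp add: integral_const_def)

lemma stable_integral_moment:
  assumes J: "has_stable_integral M F Z \<alpha> T H J"
    and h: "h \<in> borel_measurable borel" "\<And>s. 0 \<le> h s"
    and bound: "AE \<omega> in M. AE s in lborel. 0 < s \<and> s \<le> T \<longrightarrow> \<bar>H s \<omega>\<bar> \<le> h s"
    and R: "(\<integral>\<^sup>+s\<in>{0<..T}. ennreal (h s powr \<alpha>) \<partial>lborel) \<le> ennreal R" "0 < R"
  shows "(\<integral>\<^sup>+\<omega>. ennreal \<bar>J \<omega>\<bar> \<partial>M) \<le> ennreal (integral_const * R powr (1 / \<alpha>))"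
proof -
  have pos: "0 < char_const \<alpha>" using char_const_ge_1[of \<alpha>] by simp
  have "(\<integral>\<^sup>+\<omega>. ennreal \<bar>J \<omega>\<bar> \<partial>M) \<le>
      ennreal (moment_const \<alpha> * (char_const \<alpha> * 2 powr \<alpha> * 2 * R) powr (1 / \<alpha>))"
  proof (rule abs_moment_le_char[OF _ alpha])
    show "random_variable borel J" using J by (simp add: has_stable_integral_def)
    show "norm ((\<integral>\<omega>. iexp (u * J \<omega>) \<partial>M) - 1) \<le> char_const \<alpha> * 2 powr \<alpha> * 2 * R * u powr \<alpha>"
      if "0 < u" for u
      using stable_integral_char_bound[OF J h bound R, of u] that by (simp add: mult_ac)
  qed (use pos R in simp)
  then show ?thesis
    using pos R by (simp add: integral_const_def powr_mult mult_ac)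
qed

end

section \<open>Paths of the model\<close>

lemma cadlag_on_bounded:
  assumes f: "cadlag_on {a..b} f"
  shows "bounded (f ` {a..b})"
proof -
  have "\<exists>U. open U \<and> t \<in> U \<and> bounded (f ` (U \<inter> {a..b}))" if t: "t \<in> {a..b}" for t
  proof -
    obtain l where r: "(f \<longlongrightarrow> f t) (at t within {a..b} \<inter> {t<..})"
      and l: "(f \<longlongrightarrow> l) (at t within {a..b} \<inter> {..<t})"
      using f t unfolding cadlag_on_def by blast
    obtain S1 where S1: "open S1" "t \<in> S1" "\<And>x. x \<in> S1 \<Longrightarrow> x \<noteq> t \<Longrightarrow> x \<in> {a..b} \<inter> {t<..} \<Longrightarrow> dist (f x) (f t) < 1"
      using tendstoD[OF r, of 1] unfolding eventually_at_topological by auto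
    obtain S2 where S2: "open S2" "t \<in> S2" "\<And>x. x \<in> S2 \<Longrightarrow> x \<noteq> t \<Longrightarrow> x \<in> {a..b} \<inter> {..<t} \<Longrightarrow> dist (f x) l < 1"
      using tendstoD[OF l, of 1] unfolding eventually_at_topological by auto
    have "\<bar>f x\<bar> \<le> \<bar>f t\<bar> + \<bar>l\<bar> + 1" if x: "x \<in> S1 \<inter> S2 \<inter> {a..b}" for x
    proof (cases x t rule: linorder_cases)
      case less
      then have "dist (f x) l < 1" using S2(3)[of x] x by auto
      then show ?thesis by (simp add: dist_real_def)
    next
      case greater
      then have "dist (f x) (f t) < 1" using S1(3)[of x] x by auto
      then show ?thesis by (simp add: dist_real_def)
    qed simp
    then have "bounded (f ` (S1 \<inter> S2 \<inter> {a..b}))"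
      by (intro boundedI[where B = "\<bar>f t\<bar> + \<bar>l\<bar> + 1"]) auto
    then show ?thesis using S1 S2 by (intro exI[of _ "S1 \<inter> S2"]) auto
  qed
  then obtain U where U: "\<And>t. t \<in> {a..b} \<Longrightarrow> open (U t) \<and> t \<in> U t \<and> bounded (f ` (U t \<inter> {a..b}))"
    by metis
  obtain C where C: "C \<subseteq> {a..b}" "finite C" "{a..b} \<subseteq> (\<Union>t\<in>C. U t)"
    by (rule compactE_image[OF compact_Icc[of a b], of "{a..b}" U]) (use U in auto)
  have "bounded (\<Union>t\<in>C. f ` (U t \<inter> {a..b}))"
    using C U by (intro bounded_UN) auto
  moreover have "f ` {a..b} \<subseteq> (\<Union>t\<in>C. f ` (U t \<inter> {a..b}))"
  proof (rule image_subsetI)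
    fix s assume "s \<in> {a..b}"
    moreover from this obtain t where "t \<in> C" "s \<in> U t" using C(3) by blast
    ultimately show "f s \<in> (\<Union>t\<in>C. f ` (U t \<inter> {a..b}))" by blast
  qed
  ultimately show ?thesis by (rule bounded_subset)
qed

lemma cadlag_on_abs_bound:
  assumes "cadlag_on {a..b} f"
  obtains B where "\<And>s. s \<in> {a..b} \<Longrightarrow> \<bar>f s\<bar> \<le> B"
  using cadlag_on_bounded[OF assms] unfolding bounded_iff real_norm_def by blast

lemma cadlag_on_measurable:
  assumes f: "cadlag_on {0..T} f" and T: "0 < T"
  shows "(\<lambda>s. indicator {0..T} s * f s) \<in> borel_measurable borel"
proof (rule borel_measurable_LIMSEQ_real)
  fix s
  show "(\<lambda>n. indicator {0..T} s * f (dyadic_above T n s)) \<longlonglongrightarrow> indicator {0..T} s * f s"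
    using cadlag_dyadic_tendsto[OF f _ T, of s]
    by (cases "s \<in> {0..T}") (auto intro!: tendsto_mult)
next
  fix n
  have "(\<lambda>s. \<lfloor>s * 2 ^ n / T\<rfloor>) \<in> measurable borel (count_space UNIV)"
    by measurable
  from measurable_compose[OF this, of "\<lambda>i. f (min T ((of_int i + 1) * (T / 2 ^ n)))" borel]
  have [measurable]: "(\<lambda>s. f (dyadic_above T n s)) \<in> borel_measurable borel"
    by (simp add: dyadic_above_def)
  show "(\<lambda>s. indicator {0..T} s * f (dyadic_above T n s)) \<in> borel_measurable borel"
    by measurable
qed

lemma continuous_cadlag_on:
  "continuous_on I f \<Longrightarrow> cadlag_on I f"
  unfolding cadlag_on_def continuous_on_def
  by (meson Int_lower1 tendsto_within_subset)

lemma cadlag_on_mult: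
  assumes "cadlag_on I f" "cadlag_on I g"
  shows "cadlag_on I (\<lambda>s. f s * g s)"
  using assms unfolding cadlag_on_def by (blast intro: tendsto_mult)

lemma integrable_Icc_const: "integrable lborel (\<lambda>s. indicator {a..b::real} s * (c :: real))"
  by (intro integrable_mult_left integrable_real_indicator) (auto simp: emeasure_lborel_Icc_eq)

lemma cadlag_on_set_integrable:
  assumes f: "cadlag_on {0..T} f" and T: "0 < T" and t: "t \<in> {0..T}"
  shows "set_integrable lborel {0..t} f"
proof -
  obtain B where B: "\<And>s. s \<in> {0..T} \<Longrightarrow> \<bar>f s\<bar> \<le> B"
    using cadlag_on_abs_bound[OF f] by blast
  have B0: "0 \<le> B" using B[of 0] T by auto
  have "integrable lborel (\<lambda>s. indicator {0..T} s * f s)"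
  proof (rule Bochner_Integration.integrable_bound)
    show "integrable lborel (\<lambda>s. indicator {0..T} s * B)"
      by (rule integrable_Icc_const)
    show "(\<lambda>s. indicator {0..T} s * f s) \<in> borel_measurable lborel"
      using cadlag_on_measurable[OF f T] by simp
  qed (use B B0 in \<open>auto simp: indicator_def\<close>)
  then have "set_integrable lborel {0..T} f" by (simp add: set_integrable_def)
  then show ?thesis by (rule set_integrable_subset) (use t in auto)
qed

text \<open>Gronwall's inequality for the difference to the noiseless path is replaced by a
  supremum over the weighted difference, which needs no continuity.\<close>

lemma path_lower_bound:
  assumes T: "0 < T" and x0: "0 < x0" and L: "0 < L"
    and \<theta>: "continuous_on {0..T} \<theta>" "\<And>t. t \<in> {0..T} \<Longrightarrow> \<bar>\<theta> t\<bar> \<le> L"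
    and x: "cadlag_on {0..T} x"
    and eq: "\<And>t. t \<in> {0..T} \<Longrightarrow> x t = x0 + (LBINT s:{0..t}. \<theta> s * x s) + z t"
    and z: "\<And>t. t \<in> {0..T} \<Longrightarrow> \<bar>z t\<bar> \<le> x0 * exp (- 3 * L * T) / 4"
    and t: "t \<in> {0..T}"
  shows "1 / 2 * x0 * exp (- L * t) \<le> x t"
proof -
  obtain g where g: "\<And>s. s \<in> {0..T} \<Longrightarrow> (g has_vector_derivative \<theta> s) (at s within {0..T})"
    using antiderivative_continuous[OF \<theta>(1)] by blast
  define y where "y s = x0 * exp (g s - g 0)" for s
  define \<delta> where "\<delta> = x0 * exp (- 3 * L * T) / 4"
  have y': "(y has_vector_derivative \<theta> s * y s) (at s within {0..T})" if "s \<in> {0..T}" for s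
    using g[OF that] unfolding y_def has_real_derivative_iff_has_vector_derivative[symmetric]
    by (auto intro!: derivative_eq_intros)
  have ycont: "continuous_on {0..T} y"
    using y' by (meson continuous_on_eq_continuous_within has_vector_derivative_continuous)
  have sub: "{0..s} \<subseteq> {0..T}" if "s \<in> {0..T}" for s using that by auto
  have yint: "(LBINT r:{0..s}. \<theta> r * y r) = y s - x0" if s: "s \<in> {0..T}" for s
  proof -
    have "(LBINT r:{0..s}. \<theta> r * y r) = y s - y 0"
      unfolding set_lebesgue_integral_def
    proof (rule integral_FTC_atLeastAtMost)
      show "(y has_vector_derivative \<theta> r * y r) (at r within {0..s})" if "0 \<le> r" "r \<le> s" for r
        using has_vector_derivative_within_subset[OF y'[of r] sub[OF s]] that s by auto
      show "continuous_on {0..s} (\<lambda>r. \<theta> r * y r)"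
        using \<theta>(1) ycont sub[OF s] by (intro continuous_on_mult) (auto intro: continuous_on_subset)
    qed (use s in auto)
    then show ?thesis by (simp add: y_def)
  qed
  have gint: "(LBINT r:{0..s}. \<theta> r) = g s - g 0" if s: "s \<in> {0..T}" for s
    unfolding set_lebesgue_integral_def
  proof (rule integral_FTC_atLeastAtMost)
    show "(g has_vector_derivative \<theta> r) (at r within {0..s})" if "0 \<le> r" "r \<le> s" for r
      using has_vector_derivative_within_subset[OF g[of r] sub[OF s]] that s by auto
    show "continuous_on {0..s} \<theta>" using \<theta>(1) sub[OF s] by (rule continuous_on_subset)
  qed (use s in auto)
  have ylow: "x0 * exp (- L * t) \<le> y t"
  proof -
    have "set_integrable lborel {0..t} \<theta>"
      by (rule cadlag_on_set_integrable[OF continuous_cadlag_on[OF \<theta>(1)] T t])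
    then have "(LBINT r:{0..t}. - L) \<le> (LBINT r:{0..t}. \<theta> r)"
      using \<theta>(2) t by (intro set_integral_mono) (force simp: set_integrable_def abs_le_iff)+
    also have "(LBINT r:{0..t}. - L) = - L * t"
      using t by (simp add: set_lebesgue_integral_def)
    finally show ?thesis using gint[OF t] x0 by (simp add: y_def)
  qed
  define f where "f s = \<bar>x s - y s\<bar>" for s
  have dcad: "cadlag_on {0..T} (\<lambda>s. \<theta> s * x s)" "cadlag_on {0..T} (\<lambda>s. \<theta> s * y s)"
    by (intro cadlag_on_mult continuous_cadlag_on \<theta>(1) ycont x)+
  obtain Bx where Bx: "\<And>s. s \<in> {0..T} \<Longrightarrow> \<bar>x s\<bar> \<le> Bx"
    using cadlag_on_abs_bound[OF x] by blast
  obtain By where By: "\<And>s. s \<in> {0..T} \<Longrightarrow> \<bar>y s\<bar> \<le> By"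
    using cadlag_on_abs_bound[OF continuous_cadlag_on[OF ycont]] by blast
  define m where "m = (SUP s\<in>{0..T}. f s * exp (- 2 * L * s))"
  have bdd: "bdd_above ((\<lambda>s. f s * exp (- 2 * L * s)) ` {0..T})"
  proof (rule bdd_aboveI2)
    fix s assume s: "s \<in> {0..T}"
    have "f s \<le> Bx + By" using Bx[OF s] By[OF s] by (simp add: f_def)
    moreover have "f s * exp (- 2 * L * s) \<le> f s * 1"
      using s L by (intro mult_left_mono) (auto simp: f_def)
    ultimately show "f s * exp (- 2 * L * s) \<le> Bx + By" by linarith
  qed
  have fm: "f s \<le> m * exp (2 * L * s)" if s: "s \<in> {0..T}" for s
  proof -
    have "f s * exp (- 2 * L * s) \<le> m"
      unfolding m_def by (rule cSUP_upper[OF s bdd])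
    then have "f s * exp (- 2 * L * s) * exp (2 * L * s) \<le> m * exp (2 * L * s)"
      by (rule mult_right_mono) simp
    then show ?thesis by (simp add: mult.assoc flip: exp_add)
  qed
  have m0: "0 \<le> m" using fm[of 0] T by (auto simp: f_def intro: order_trans[rotated])
  have step: "f s * exp (- 2 * L * s) \<le> m / 2 + \<delta>" if s: "s \<in> {0..T}" for s
  proof -
    have int: "set_integrable lborel {0..s} (\<lambda>r. \<theta> r * x r)" "set_integrable lborel {0..s} (\<lambda>r. \<theta> r * y r)"
      by (intro cadlag_on_set_integrable[OF _ T s] dcad)+
    have iexp: "set_integrable lborel {0..s} (\<lambda>r. L * m * exp (2 * L * r))"
      by (intro cadlag_on_set_integrable[OF _ T s] continuous_cadlag_on continuous_intros)
    have "x s - y s = (LBINT r:{0..s}. \<theta> r * x r) - (LBINT r:{0..s}. \<theta> r * y r) + z s"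
      using eq[OF s] yint[OF s] by simp
    also have "\<dots> = (LBINT r:{0..s}. \<theta> r * x r - \<theta> r * y r) + z s"
      using int by (simp add: set_integral_diff)
    finally have "f s \<le> \<bar>LBINT r:{0..s}. \<theta> r * x r - \<theta> r * y r\<bar> + \<delta>"
      using z[OF s] by (simp add: f_def \<delta>_def)
    also have "\<bar>LBINT r:{0..s}. \<theta> r * x r - \<theta> r * y r\<bar> \<le> (LBINT r:{0..s}. \<bar>\<theta> r * x r - \<theta> r * y r\<bar>)"
      using integral_norm_bound[of lborel "\<lambda>r. indicator {0..s} r *\<^sub>R (\<theta> r * x r - \<theta> r * y r)"]
      by (simp add: set_lebesgue_integral_def abs_mult)
    also have "\<dots> \<le> (LBINT r:{0..s}. L * m * exp (2 * L * r))"
    proof (rule set_integral_mono[OF _ iexp])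
      show "set_integrable lborel {0..s} (\<lambda>r. \<bar>\<theta> r * x r - \<theta> r * y r\<bar>)"
        using int by (intro set_integrable_abs set_integral_diff(1))
      fix r assume "r \<in> {0..s}"
      then have r: "r \<in> {0..T}" using s by auto
      have "\<bar>\<theta> r * x r - \<theta> r * y r\<bar> = \<bar>\<theta> r\<bar> * f r"
        by (simp add: f_def abs_mult flip: right_diff_distrib)
      also have "\<dots> \<le> L * (m * exp (2 * L * r))"
        using \<theta>(2)[OF r] fm[OF r] L by (intro mult_mono) (auto simp: f_def)
      finally show "\<bar>\<theta> r * x r - \<theta> r * y r\<bar> \<le> L * m * exp (2 * L * r)" by (simp add: mult.assoc)
    qed
    also have "(LBINT r:{0..s}. L * m * exp (2 * L * r)) = m / 2 * exp (2 * L * s) - m / 2 * exp (2 * L * 0)"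
      unfolding set_lebesgue_integral_def
    proof (rule integral_FTC_atLeastAtMost)
      show "((\<lambda>r. m / 2 * exp (2 * L * r)) has_vector_derivative L * m * exp (2 * L * r)) (at r within {0..s})" for r
        unfolding has_real_derivative_iff_has_vector_derivative[symmetric]
        by (auto intro!: derivative_eq_intros)
    qed (use s in \<open>auto intro!: continuous_intros\<close>)
    finally have "f s \<le> m / 2 * exp (2 * L * s) + \<delta>" using m0 by simp
    then have "f s * exp (- 2 * L * s) \<le> (m / 2 * exp (2 * L * s) + \<delta>) * exp (- 2 * L * s)"
      by (rule mult_right_mono) simp
    also have "\<dots> = m / 2 + \<delta> * exp (- 2 * L * s)"
      by (simp add: distrib_right mult.assoc flip: exp_add)
    also have "\<dots> \<le> m / 2 + \<delta> * 1"
      using x0 s L by (intro add_left_mono mult_left_mono) (auto simp: \<delta>_def)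
    finally show ?thesis by simp
  qed
  have "m \<le> m / 2 + \<delta>"
    unfolding m_def by (rule cSUP_least) (use T step m_def in auto)
  then have "m \<le> 2 * \<delta>" by simp
  then have "f t \<le> 2 * \<delta> * exp (2 * L * t)"
    using fm[OF t] by (meson mult_right_mono exp_ge_zero order_trans)
  also have "\<dots> = x0 / 2 * exp (2 * L * t - 3 * L * T)"
    by (simp add: \<delta>_def exp_diff exp_minus field_simps)
  also have "\<dots> \<le> x0 / 2 * exp (- L * t)"
    using t L x0 by (intro mult_left_mono) auto
  finally show ?thesis using ylow unfolding f_def by linarith
qed

section \<open>Bias of the kernel estimator\<close>

lemma hoelder_class_continuous:
  assumes "\<theta> \<in> hoelder_class T L k \<gamma> L\<gamma>" "1 \<le> k"
  shows "continuous_on {0..T} \<theta>"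
proof -
  obtain D where D: "D 0 = \<theta>" "\<And>t. t \<in> {0..T} \<Longrightarrow> (D 0 has_real_derivative D (Suc 0) t) (at t within {0..T})"
    using assms by (force simp: hoelder_class_def)
  then show ?thesis
    by (metis DERIV_continuous continuous_on_eq_continuous_within)
qed

lemma taylor_hoelder:
  fixes D :: "nat \<Rightarrow> real \<Rightarrow> real"
  assumes k: "1 \<le> k"
    and D: "\<And>j r. j < k \<Longrightarrow> r \<in> {0..T} \<Longrightarrow> (D j has_real_derivative D (Suc j) r) (at r within {0..T})"
    and H: "\<And>r q. r \<in> {0..T} \<Longrightarrow> q \<in> {0..T} \<Longrightarrow> \<bar>D k q - D k r\<bar> \<le> C * \<bar>q - r\<bar> powr \<gamma>"
    and C: "0 < C" and \<gamma>: "0 < \<gamma>"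
    and t: "0 < t" "t < T" and s: "0 < s" "s < T"
  shows "\<bar>D 0 s - (\<Sum>j\<le>k. D j t / fact j * (s - t) ^ j)\<bar> \<le> C * \<bar>s - t\<bar> powr (real k + \<gamma>)"
proof (cases "s = t")
  case True
  have "(\<Sum>j\<le>k. D j t / fact j * 0 ^ j) = D 0 t"
    by (simp add: power_0_left if_distrib cong: if_cong)
  then show ?thesis using True by simp
next
  case False
  have "\<exists>r. (if s < t then s < r \<and> r < t else t < r \<and> r < s) \<and>
      D 0 s = (\<Sum>j<k. D j t / fact j * (s - t) ^ j) + D k r / fact k * (s - t) ^ k"
  proof (rule Taylor[where a = "min s t" and b = "max s t"])
    show "\<forall>j r. j < k \<and> min s t \<le> r \<and> r \<le> max s t \<longrightarrow> DERIV (D j) r :> D (Suc j) r"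
    proof (intro allI impI)
      fix j r assume jr: "j < k \<and> min s t \<le> r \<and> r \<le> max s t"
      then have "0 < r" "r < T" using s t by auto
      then show "DERIV (D j) r :> D (Suc j) r"
        using D[of j r] jr by (simp add: at_within_Icc_at)
    qed
  qed (use k False in auto)
  then obtain r where r: "if s < t then s < r \<and> r < t else t < r \<and> r < s"
    "D 0 s = (\<Sum>j<k. D j t / fact j * (s - t) ^ j) + D k r / fact k * (s - t) ^ k" by blast
  have "{..k} = insert k {..<k}" by auto
  then have "D 0 s - (\<Sum>j\<le>k. D j t / fact j * (s - t) ^ j) = (D k r - D k t) / fact k * (s - t) ^ k"
    using r(2) by (simp add: diff_divide_distrib left_diff_distrib)
  then have "\<bar>D 0 s - (\<Sum>j\<le>k. D j t / fact j * (s - t) ^ j)\<bar> = \<bar>D k r - D k t\<bar> / fact k * \<bar>s - t\<bar> ^ k"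
    by (simp add: abs_mult power_abs)
  also have "\<dots> \<le> \<bar>D k r - D k t\<bar> * \<bar>s - t\<bar> ^ k"
    by (intro mult_right_mono) (auto simp: divide_le_eq mult_le_cancel_left1 intro: fact_ge_1)
  also have "\<dots> \<le> (C * \<bar>s - t\<bar> powr \<gamma>) * \<bar>s - t\<bar> ^ k"
  proof (intro mult_right_mono)
    have rr: "r \<in> {0..T}" "\<bar>r - t\<bar> \<le> \<bar>s - t\<bar>" using r(1) s t by (auto split: if_splits)
    have "\<bar>D k r - D k t\<bar> \<le> C * \<bar>r - t\<bar> powr \<gamma>" using H[of t r] rr t by auto
    also have "\<dots> \<le> C * \<bar>s - t\<bar> powr \<gamma>"
      using rr C \<gamma> by (intro mult_left_mono powr_mono2) auto
    finally show "\<bar>D k r - D k t\<bar> \<le> C * \<bar>s - t\<bar> powr \<gamma>" .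
  qed auto
  also have "\<dots> = C * \<bar>s - t\<bar> powr (real k + \<gamma>)"
    using False by (simp add: powr_add powr_realpow)
  finally show ?thesis .
qed

lemma kernel_bias:
  assumes \<theta>: "\<theta> \<in> hoelder_class T L k \<gamma> C"
    and k: "1 \<le> k" and \<gamma>: "0 < \<gamma>" and C: "0 < C" and AB: "A < 0" "0 < B"
    and G [measurable]: "G \<in> borel_measurable borel" and b: "\<And>u. \<bar>G u\<bar> \<le> b"
    and supp: "\<And>u. u < A \<or> B < u \<Longrightarrow> G u = 0"
    and one: "(LBINT u:{A..B}. G u) = 1"
    and moments: "\<And>j. 1 \<le> j \<Longrightarrow> j \<le> k \<Longrightarrow> (LBINT u. u ^ j * G u) = 0"
    and \<phi>: "0 < \<phi>" and t: "\<phi> * B < t" "t - \<phi> * A < T"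
  shows "\<bar>1 / \<phi> * (LBINT s:{0..T}. G ((t - s) / \<phi>) * \<theta> s) - \<theta> t\<bar> \<le>
    b * C * max (- A) B powr (real k + \<gamma>) * (B - A) * \<phi> powr (real k + \<gamma>)"
proof -
  obtain D where D0: "D 0 = \<theta>"
    and D: "\<And>j r. j < k \<Longrightarrow> r \<in> {0..T} \<Longrightarrow> (D j has_real_derivative D (Suc j) r) (at r within {0..T})"
    and H: "\<And>r q. r \<in> {0..T} \<Longrightarrow> q \<in> {0..T} \<Longrightarrow> \<bar>D k q - D k r\<bar> \<le> C * \<bar>q - r\<bar> powr \<gamma>"
    using \<theta> unfolding hoelder_class_def by blast
  have b0: "0 \<le> b" using b[of 0] by simp
  have tT: "0 < t" "t < T"
    using t \<phi> AB mult_pos_pos[of \<phi> B] mult_pos_neg[of \<phi> A] by linarith+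
  have inside: "0 < t - \<phi> * u" "t - \<phi> * u < T" if "u \<in> {A..B}" for u
  proof -
    have "\<phi> * u \<le> \<phi> * B" "\<phi> * A \<le> \<phi> * u" using \<phi> that by (auto intro!: mult_left_mono)
    then show "0 < t - \<phi> * u" "t - \<phi> * u < T" using t by linarith+
  qed
  have supp': "u \<in> {A..B}" if "G u \<noteq> 0" for u
    using supp[of u] that by (meson atLeastAtMost_iff not_less)
  define p where "p u = (\<Sum>j\<le>k. D j t / fact j * (- \<phi> * u) ^ j)" for u
  have intG: "integrable lborel (\<lambda>u. u ^ j * G u)" for j
  proof (rule Bochner_Integration.integrable_bound)
    show "integrable lborel (\<lambda>u. indicator {A..B} u * (max (- A) B ^ j * b))"
      by (rule integrable_Icc_const)
    show "AE u in lborel. norm (u ^ j * G u) \<le> norm (indicator {A..B} u * (max (- A) B ^ j * b))"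
    proof (intro AE_I2)
      fix u
      show "norm (u ^ j * G u) \<le> norm (indicator {A..B} u * (max (- A) B ^ j * b))"
      proof (cases "u \<in> {A..B}")
        case True
        then have "\<bar>u\<bar> ^ j * \<bar>G u\<bar> \<le> max (- A) B ^ j * b"
          using b AB by (intro mult_mono power_mono) auto
        then show ?thesis using True AB b0 by (simp add: abs_mult power_abs)
      qed (use supp' in auto)
    qed
  qed measurable
  have G1: "(LBINT u. G u) = 1"
  proof -
    have "indicator {A..B} u *\<^sub>R G u = G u" for u using supp'[of u] by (cases "G u = 0") auto
    then show ?thesis using one unfolding set_lebesgue_integral_def by (simp only:)
  qed
  have pG: "(\<lambda>u. p u * G u) = (\<lambda>u. \<Sum>j\<le>k. (D j t / fact j * (- \<phi>) ^ j) * (u ^ j * G u))"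
    unfolding p_def sum_distrib_right power_mult_distrib by (simp only: mult.assoc)
  have intp: "integrable lborel (\<lambda>u. p u * G u)"
    unfolding pG using intG by (intro Bochner_Integration.integrable_sum integrable_mult_right)
  have "(LBINT u. p u * G u) = (\<Sum>j\<le>k. (D j t / fact j * (- \<phi>) ^ j) * (LBINT u. u ^ j * G u))"
    unfolding pG using intG by (subst Bochner_Integration.integral_sum) auto
  also have "\<dots> = (\<Sum>j\<le>k. if j = 0 then \<theta> t else 0)"
  proof (rule sum.cong)
    fix j assume "j \<in> {..k}"
    then show "(D j t / fact j * (- \<phi>) ^ j) * (LBINT u. u ^ j * G u) = (if j = 0 then \<theta> t else 0)"
      using moments[of j] G1 D0 by (cases "j = 0") auto
  qed simp
  also have "\<dots> = \<theta> t" by simp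
  finally have p1: "(LBINT u. p u * G u) = \<theta> t" .
  define f where "f s = indicator {0..T} s * (G ((t - s) / \<phi>) * \<theta> s)" for s
  have meas: "(\<lambda>s. indicator {0..T} s * \<theta> s) \<in> borel_measurable borel"
    using tT by (intro cadlag_on_measurable continuous_cadlag_on hoelder_class_continuous[OF \<theta> k]) auto
  have "f = (\<lambda>s. G ((t - s) / \<phi>) * (indicator {0..T} s * \<theta> s))" by (auto simp: f_def)
  then have fm [measurable]: "f \<in> borel_measurable borel" using meas by simp
  have fu: "f (t + (- \<phi>) * u) = G u * \<theta> (t - \<phi> * u)" for u
    using supp'[of u] inside[of u] \<phi> by (cases "G u = 0") (auto simp: f_def)
  have "(LBINT s. f s) = \<bar>- \<phi>\<bar> *\<^sub>R (LBINT u. f (t + (- \<phi>) * u))"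
    using \<phi> by (intro lborel_integral_real_affine) auto
  then have "(LBINT s:{0..T}. G ((t - s) / \<phi>) * \<theta> s) = \<phi> * (LBINT u. G u * \<theta> (t - \<phi> * u))"
    using \<phi> unfolding fu by (simp add: set_lebesgue_integral_def f_def)
  then have "1 / \<phi> * (LBINT s:{0..T}. G ((t - s) / \<phi>) * \<theta> s) - \<theta> t =
      (LBINT u. f (t + (- \<phi>) * u)) - (LBINT u. p u * G u)"
    using \<phi> unfolding fu p1 by simp
  also have "\<dots> = (LBINT u. f (t + (- \<phi>) * u) - p u * G u)"
  proof (rule Bochner_Integration.integral_diff[symmetric, OF _ intp])
    have "\<And>s. s \<in> {0..T} \<Longrightarrow> \<bar>\<theta> s\<bar> \<le> L" using \<theta> by (simp add: hoelder_class_def)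
    then have thb: "\<bar>\<theta> (t - \<phi> * u)\<bar> \<le> L" if "u \<in> {A..B}" for u
      using inside[OF that] by auto
    show "integrable lborel (\<lambda>u. f (t + - \<phi> * u))"
    proof (rule Bochner_Integration.integrable_bound)
      show "integrable lborel (\<lambda>u. indicator {A..B} u * (b * L))"
        by (rule integrable_Icc_const)
      show "AE u in lborel. norm (f (t + - \<phi> * u)) \<le> norm (indicator {A..B} u * (b * L))"
      proof (intro AE_I2)
        fix u
        show "norm (f (t + - \<phi> * u)) \<le> norm (indicator {A..B} u * (b * L))"
        proof (cases "u \<in> {A..B}")
          case True
          then have "\<bar>G u\<bar> * \<bar>\<theta> (t - \<phi> * u)\<bar> \<le> b * L"
            using b b0 thb by (intro mult_mono) auto
          also have "\<dots> \<le> \<bar>b * L\<bar>" by simp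
          finally show ?thesis using True unfolding fu by (simp add: abs_mult)
        qed (use supp' fu in auto)
      qed
    qed measurable
  qed
  also have "\<bar>\<dots>\<bar> \<le> (LBINT u. \<bar>f (t + (- \<phi>) * u) - p u * G u\<bar>)"
    by (rule integral_abs_bound)
  also have "\<dots> \<le> (LBINT u. indicator {A..B} u * (b * (C * (\<phi> * max (- A) B) powr (real k + \<gamma>))))"
  proof (rule integral_mono')
    show "integrable lborel (\<lambda>u. indicator {A..B} u * (b * (C * (\<phi> * max (- A) B) powr (real k + \<gamma>))))"
      by (rule integrable_Icc_const)
    fix u
    show "0 \<le> indicator {A..B} u * (b * (C * (\<phi> * max (- A) B) powr (real k + \<gamma>)))"
      using b0 C by auto
    show "\<bar>f (t + (- \<phi>) * u) - p u * G u\<bar> \<le>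
        indicator {A..B} u * (b * (C * (\<phi> * max (- A) B) powr (real k + \<gamma>)))"
    proof (cases "u \<in> {A..B}")
      case True
      have "f (t + (- \<phi>) * u) - p u * G u = G u * (D 0 (t - \<phi> * u) - p u)"
        unfolding fu D0 by (simp add: algebra_simps)
      then have "\<bar>f (t + (- \<phi>) * u) - p u * G u\<bar> = \<bar>G u\<bar> * \<bar>D 0 (t - \<phi> * u) - p u\<bar>"
        by (simp add: abs_mult)
      also have "\<dots> \<le> b * (C * (\<phi> * max (- A) B) powr (real k + \<gamma>))"
      proof (rule mult_mono)
        have "\<bar>D 0 (t - \<phi> * u) - p u\<bar> \<le> C * \<bar>t - \<phi> * u - t\<bar> powr (real k + \<gamma>)"
          using taylor_hoelder[OF k D H C \<gamma> tT inside[OF True]] by (simp add: p_def)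
        also have "\<dots> \<le> C * (\<phi> * max (- A) B) powr (real k + \<gamma>)"
        proof (intro mult_left_mono powr_mono2)
          have "\<bar>u\<bar> \<le> max (- A) B" using True by auto
          then show "\<bar>t - \<phi> * u - t\<bar> \<le> \<phi> * max (- A) B"
            using \<phi> by (simp add: abs_mult)
        qed (use C \<gamma> in auto)
        finally show "\<bar>D 0 (t - \<phi> * u) - p u\<bar> \<le> C * (\<phi> * max (- A) B) powr (real k + \<gamma>)" .
      qed (use b b0 in auto)
      finally show ?thesis using True by simp
    qed (use supp' fu in auto)
  qed
  also have "\<dots> = b * C * max (- A) B powr (real k + \<gamma>) * (B - A) * \<phi> powr (real k + \<gamma>)"
    using AB \<phi> by (simp add: powr_mult mult_ac)
  finally show ?thesis .
qed

section \<open>Risk of the estimator\<close>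

context stable_noise begin

lemma estimator_error:
  assumes params: "0 < T" "0 < x0" "0 < L" "0 < C"
    and k: "1 \<le> k" and \<gamma>: "0 < \<gamma>" and AB: "A < 0" "0 < B"
    and G: "G \<in> borel_measurable borel" and b: "0 < b" "\<And>u. \<bar>G u\<bar> \<le> b"
    and supp: "\<And>u. u < A \<or> B < u \<Longrightarrow> G u = 0"
    and one: "(LBINT u:{A..B}. G u) = 1"
    and moments: "\<And>j. 1 \<le> j \<Longrightarrow> j \<le> k \<Longrightarrow> (LBINT u. u ^ j * G u) = 0"
    and pos: "0 < \<epsilon>" "0 < \<phi>"
    and \<theta>: "\<theta> \<in> hoelder_class T L k \<gamma> C"
    and sol: "sde_solution M F Z T x0 \<epsilon> \<theta> X"
    and est: "is_estimator M F Z \<alpha> T x0 L G \<phi> \<epsilon> \<theta> X t E"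
    and t: "\<phi> * B < t" "t - \<phi> * A < T"
  shows "(\<integral>\<^sup>+\<omega>. ennreal \<bar>E \<omega> - \<theta> t\<bar> \<partial>M) \<le> ennreal (
    integral_const * (2 * exp (L * T) / x0 * b) * (B - A) powr (1 / \<alpha>) * (\<epsilon> * \<phi> powr (1 / \<alpha> - 1)) +
    b * C * max (- A) B powr (real k + \<gamma>) * (B - A) * \<phi> powr (real k + \<gamma>) +
    (L + L * b * (B - A)) * (moment_const \<alpha> * (char_const \<alpha> * T) powr (1 / \<alpha>) /
      (x0 * exp (- 3 * L * T) / 4)) * \<epsilon>)"
proof -
  define c1 where "c1 = 2 * exp (L * T) / x0"
  have c1: "0 < c1" using params by (simp add: c1_def)
  have tT: "0 < t" "t < T"
    using t pos AB mult_pos_pos[of \<phi> B] mult_pos_neg[of \<phi> A] by linarith+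
  have \<theta>L: "\<bar>\<theta> s\<bar> \<le> L" if "s \<in> {0..T}" for s
    using \<theta> that by (simp add: hoelder_class_def)
  have cad: "cadlag_on {0..T} (\<lambda>s. X s \<omega>)" if "\<omega> \<in> space M" for \<omega>
    using sol that by (simp add: sde_solution_def)
  define V where "V s \<omega> = inverse (X s \<omega>) * indicat_real (above_event M x0 L X s) \<omega>" for s \<omega>
  define U where "U \<omega> = (LBINT s:{0..T}. G ((t - s) / \<phi>) *
    (\<theta> s * indicat_real (above_event M x0 L X s) \<omega>))" for \<omega>
  obtain K J S where K: "left_limit_version M F T V K"
    and S: "has_stable_integral M F Z \<alpha> T (\<lambda>s \<omega>. G ((t - s) / \<phi>) * (\<epsilon> * K s \<omega>)) S"
    and J: "\<And>\<omega>. \<omega> \<in> space M \<Longrightarrow> J \<omega> = U \<omega> + S \<omega>"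
    and E: "\<And>\<omega>. \<omega> \<in> space M \<Longrightarrow> E \<omega> = indicat_real (above_event M x0 L X T) \<omega> * (1 / \<phi> * J \<omega>)"
    using est unfolding is_estimator_def has_differential_integral_def V_def[abs_def] U_def by blast
  have V: "\<bar>V r \<omega>\<bar> \<le> c1" if \<omega>: "\<omega> \<in> space M" and r: "r \<in> {0..T}" for r \<omega>
  proof (cases "\<omega> \<in> above_event M x0 L X r")
    case True
    obtain B where "\<And>s. s \<in> {0..T} \<Longrightarrow> \<bar>X s \<omega>\<bar> \<le> B"
      using cadlag_on_abs_bound[OF cad[OF \<omega>]] by blast
    then have "bdd_below ((\<lambda>s. X s \<omega>) ` {0..r})"
      using r by (intro bdd_belowI2[where m = "- B"]) (force simp: abs_le_iff)
    then have "(INF s\<in>{0..r}. X s \<omega>) \<le> X r \<omega>"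
      by (rule cINF_lower) (use r in auto)
    then have "1 / 2 * x0 * exp (- L * r) \<le> X r \<omega>"
      using True by (simp add: above_event_def)
    moreover have "1 / 2 * x0 * exp (- L * T) \<le> 1 / 2 * x0 * exp (- L * r)"
      using r params by (intro mult_left_mono) auto
    ultimately have X: "1 / 2 * x0 * exp (- L * T) \<le> X r \<omega>" by linarith
    have p: "0 < 1 / 2 * x0 * exp (- L * T)" using params by simp
    have "inverse (X r \<omega>) \<le> inverse (1 / 2 * x0 * exp (- L * T))"
      by (rule le_imp_inverse_le[OF X p])
    also have "\<dots> = c1" by (simp add: c1_def exp_minus field_simps)
    finally show ?thesis using True X p by (simp add: V_def)
  qed (use c1 in \<open>simp add: V_def\<close>)
  have Kb: "AE \<omega> in M. AE s in lborel. 0 < s \<and> s \<le> T \<longrightarrow> \<bar>K s \<omega>\<bar> \<le> c1"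
  proof -
    have "AE \<omega> in M. AE s in lborel. 0 < s \<and> s \<le> T \<longrightarrow> ((\<lambda>r. V r \<omega>) \<longlongrightarrow> K s \<omega>) (at_left s)"
      using K by (simp add: left_limit_version_def)
    then show ?thesis using AE_space
    proof eventually_elim
      case (elim \<omega>)
      note \<omega> = elim(2)
      from elim(1) show "AE s in lborel. 0 < s \<and> s \<le> T \<longrightarrow> \<bar>K s \<omega>\<bar> \<le> c1"
      proof (rule AE_mp, intro AE_I2 impI)
        fix s assume lim: "0 < s \<and> s \<le> T \<longrightarrow> ((\<lambda>r. V r \<omega>) \<longlongrightarrow> K s \<omega>) (at_left s)"
          and s: "0 < s \<and> s \<le> T"
        have "((\<lambda>r. \<bar>V r \<omega>\<bar>) \<longlongrightarrow> \<bar>K s \<omega>\<bar>) (at_left s)"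
          using lim s by (intro tendsto_rabs) auto
        moreover have "\<forall>\<^sub>F r in at_left s. \<bar>V r \<omega>\<bar> \<le> c1"
          using eventually_at_left_real[of 0 s] s V[OF \<omega>] by (auto elim!: eventually_mono)
        ultimately show "\<bar>K s \<omega>\<bar> \<le> c1"
          by (intro tendsto_upperbound) auto
      qed
    qed
  qed
  have supp': "A \<le> u \<and> u \<le> B" if "G u \<noteq> 0" for u
    using supp[of u] that by (meson not_less)
  have supp_iff: "A \<le> (t - s) / \<phi> \<and> (t - s) / \<phi> \<le> B \<longleftrightarrow> s \<in> {t - \<phi> * B..t - \<phi> * A}" for s
    using pos by (auto simp: field_simps)
  let ?W = "{t - \<phi> * B..t - \<phi> * A}"
  have Gb: "\<bar>G ((t - s) / \<phi>)\<bar> \<le> indicator ?W s * b" for s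
    using supp'[of "(t - s) / \<phi>"] supp_iff[of s] b(2)[of "(t - s) / \<phi>"]
    by (cases "G ((t - s) / \<phi>) = 0") (use b in auto)
  have W: "t - \<phi> * B \<le> t - \<phi> * A" "t - \<phi> * A - (t - \<phi> * B) = \<phi> * (B - A)"
    using pos AB by (auto simp: algebra_simps)
  define h where "h s = \<epsilon> * c1 * b * indicator ?W s" for s
  define R where "R = (\<epsilon> * c1 * b) powr \<alpha> * (\<phi> * (B - A))"
  have R: "0 < R" using pos c1 b AB by (simp add: R_def)
  have Sm: "(\<integral>\<^sup>+\<omega>. ennreal \<bar>S \<omega>\<bar> \<partial>M) \<le> ennreal (integral_const * R powr (1 / \<alpha>))"
  proof (rule stable_integral_moment[OF S _ _ _ _ R])
    show "h \<in> borel_measurable borel" unfolding h_def by measurable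
    show "0 \<le> h s" for s using pos c1 b by (simp add: h_def)
    show "AE \<omega> in M. AE s in lborel. 0 < s \<and> s \<le> T \<longrightarrow> \<bar>G ((t - s) / \<phi>) * (\<epsilon> * K s \<omega>)\<bar> \<le> h s"
      using Kb
    proof eventually_elim
      case (elim \<omega>)
      then show "AE s in lborel. 0 < s \<and> s \<le> T \<longrightarrow> \<bar>G ((t - s) / \<phi>) * (\<epsilon> * K s \<omega>)\<bar> \<le> h s"
      proof (rule AE_mp, intro AE_I2 impI)
        fix s assume "0 < s \<and> s \<le> T \<longrightarrow> \<bar>K s \<omega>\<bar> \<le> c1" "0 < s \<and> s \<le> T"
        then have "\<bar>G ((t - s) / \<phi>)\<bar> * (\<epsilon> * \<bar>K s \<omega>\<bar>) \<le> (indicator ?W s * b) * (\<epsilon> * c1)"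
          using pos Gb[of s] b by (intro mult_mono) auto
        then show "\<bar>G ((t - s) / \<phi>) * (\<epsilon> * K s \<omega>)\<bar> \<le> h s"
          using pos by (simp add: h_def abs_mult mult_ac)
      qed
    qed
    have "(\<integral>\<^sup>+s\<in>{0<..T}. ennreal (h s powr \<alpha>) \<partial>lborel) \<le>
        (\<integral>\<^sup>+s. ennreal ((\<epsilon> * c1 * b) powr \<alpha>) * indicator ?W s \<partial>lborel)"
      by (intro nn_integral_mono) (auto simp: h_def indicator_def)
    also have "\<dots> = ennreal ((\<epsilon> * c1 * b) powr \<alpha>) * ennreal (\<phi> * (B - A))"
      using W by (simp add: nn_integral_cmult_indicator)
    also have "\<dots> = ennreal R"
      using pos AB by (simp add: R_def ennreal_mult')
    finally show "(\<integral>\<^sup>+s\<in>{0<..T}. ennreal (h s powr \<alpha>) \<partial>lborel) \<le> ennreal R" .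
  qed
  have Ub: "\<bar>U \<omega>\<bar> \<le> L * b * (B - A) * \<phi>" for \<omega>
  proof -
    let ?f = "\<lambda>s. indicator {0..T} s *\<^sub>R (G ((t - s) / \<phi>) *
        (\<theta> s * indicat_real (above_event M x0 L X s) \<omega>))"
    have "\<bar>U \<omega>\<bar> \<le> (LBINT s. \<bar>?f s\<bar>)"
      unfolding U_def set_lebesgue_integral_def by (rule integral_abs_bound)
    also have "\<dots> \<le> (LBINT s. indicator ?W s * (b * L))"
    proof (rule integral_mono'[OF integrable_Icc_const])
      fix s
      show "0 \<le> indicator ?W s * (b * L)" using b params by simp
      show "\<bar>?f s\<bar> \<le> indicator ?W s * (b * L)"
      proof (cases "s \<in> {0..T}")
        case True
        have "\<bar>G ((t - s) / \<phi>)\<bar> * \<bar>\<theta> s * indicat_real (above_event M x0 L X s) \<omega>\<bar> \<le>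
            (indicator ?W s * b) * L"
          using Gb[of s] \<theta>L[OF True] b params
          by (intro mult_mono) (auto simp: abs_mult indicator_def)
        then show ?thesis using True by (simp add: abs_mult mult_ac)
      qed (use b params in simp)
    qed
    also have "\<dots> = L * b * (B - A) * \<phi>"
      using W by (simp add: mult_ac)
    finally show ?thesis .
  qed
  define \<delta> where "\<delta> = x0 * exp (- 3 * L * T) / 4"
  have \<delta>: "0 < \<delta>" using params by (simp add: \<delta>_def)
  obtain N where N [measurable]: "N \<in> sets M"
    and Nm: "emeasure M N \<le> ennreal (moment_const \<alpha> * (char_const \<alpha> * T) powr (1 / \<alpha>) / (\<delta> / \<epsilon>))"
    and Nz: "\<And>\<omega> s. \<omega> \<in> space M - N \<Longrightarrow> s \<in> {0..T} \<Longrightarrow> \<bar>Z s \<omega>\<bar> \<le> \<delta> / \<epsilon>"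
    using maximal_inequality[OF params(1), of "\<delta> / \<epsilon>"] \<delta> pos by auto
  define bias where "bias = b * C * max (- A) B powr (real k + \<gamma>) * (B - A) * \<phi> powr (real k + \<gamma>)"
  have bias0: "0 \<le> bias" using b params AB by (simp add: bias_def)
  define c2 where "c2 = L + L * b * (B - A)"
  have c2: "0 \<le> c2" using b params AB by (simp add: c2_def)
  have "AE \<omega> in M. \<forall>s\<in>{0..T}.
      X s \<omega> = x0 + (LBINT r:{0..s}. \<theta> r * X r \<omega>) + \<epsilon> * Z s \<omega>"
    using sol by (simp add: sde_solution_def)
  then have bound: "AE \<omega> in M. \<bar>E \<omega> - \<theta> t\<bar> \<le> 1 / \<phi> * \<bar>S \<omega>\<bar> + bias + c2 * indicator N \<omega>"
  proof (rule AE_mp, intro AE_I2 impI)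
    fix \<omega> assume \<omega>: "\<omega> \<in> space M"
      and eq: "\<forall>s\<in>{0..T}. X s \<omega> = x0 + (LBINT r:{0..s}. \<theta> r * X r \<omega>) + \<epsilon> * Z s \<omega>"
    show "\<bar>E \<omega> - \<theta> t\<bar> \<le> 1 / \<phi> * \<bar>S \<omega>\<bar> + bias + c2 * indicator N \<omega>"
    proof (cases "\<omega> \<in> N")
      case True
      have "1 / \<phi> * \<bar>J \<omega>\<bar> \<le> 1 / \<phi> * (L * b * (B - A) * \<phi> + \<bar>S \<omega>\<bar>)"
        using J[OF \<omega>] Ub[of \<omega>] pos by (intro mult_left_mono) auto
      also have "\<dots> = L * b * (B - A) + 1 / \<phi> * \<bar>S \<omega>\<bar>" using pos by (simp add: field_simps)
      finally have 1: "1 / \<phi> * \<bar>J \<omega>\<bar> \<le> L * b * (B - A) + 1 / \<phi> * \<bar>S \<omega>\<bar>" .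
      have 2: "\<bar>E \<omega>\<bar> \<le> 1 / \<phi> * \<bar>J \<omega>\<bar>"
        unfolding E[OF \<omega>] using pos by (simp add: abs_mult indicator_def)
      have 3: "\<bar>\<theta> t\<bar> \<le> L" using \<theta>L tT by simp
      have "\<bar>E \<omega> - \<theta> t\<bar> \<le> L + (L * b * (B - A) + 1 / \<phi> * \<bar>S \<omega>\<bar>)"
        using 1 2 3 by linarith
      then show ?thesis using True bias0 by (simp add: c2_def)
    next
      case False
      have low: "1 / 2 * x0 * exp (- L * s) \<le> X s \<omega>" if s: "s \<in> {0..T}" for s
      proof (rule path_lower_bound[OF params(1-3) hoelder_class_continuous[OF \<theta> k] \<theta>L cad[OF \<omega>] _ _ s])
        show "X s \<omega> = x0 + (LBINT r:{0..s}. \<theta> r * X r \<omega>) + \<epsilon> * Z s \<omega>" if "s \<in> {0..T}" for s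
          using eq that by blast
        show "\<bar>\<epsilon> * Z s \<omega>\<bar> \<le> x0 * exp (- 3 * L * T) / 4" if "s \<in> {0..T}" for s
        proof -
          have "\<epsilon> * \<bar>Z s \<omega>\<bar> \<le> \<delta>" using Nz[of \<omega> s] \<omega> False that pos by (simp add: field_simps)
          then show ?thesis using pos by (simp add: abs_mult \<delta>_def)
        qed
      qed
      have ev: "\<omega> \<in> above_event M x0 L X s" if s: "s \<in> {0..T}" for s
      proof -
        have "1 / 2 * x0 * exp (- L * s) \<le> (INF r\<in>{0..s}. X r \<omega>)"
        proof (rule cINF_greatest)
          fix r assume r: "r \<in> {0..s}"
          then have "1 / 2 * x0 * exp (- L * s) \<le> 1 / 2 * x0 * exp (- L * r)"
            using params by (intro mult_left_mono) auto
          also have "\<dots> \<le> X r \<omega>" using low[of r] r s by auto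
          finally show "1 / 2 * x0 * exp (- L * s) \<le> X r \<omega>" .
        qed (use s in auto)
        then show ?thesis using \<omega> by (simp add: above_event_def)
      qed
      have "U \<omega> = (LBINT s:{0..T}. G ((t - s) / \<phi>) * \<theta> s)"
        unfolding U_def by (rule set_lebesgue_integral_cong) (use ev in auto)
      then have "\<bar>1 / \<phi> * U \<omega> - \<theta> t\<bar> \<le> bias"
        using kernel_bias[OF \<theta> k \<gamma> params(4) AB G b(2) supp one moments pos(2) t]
        by (simp add: bias_def)
      moreover have "E \<omega> - \<theta> t = (1 / \<phi> * U \<omega> - \<theta> t) + 1 / \<phi> * S \<omega>"
        using E[OF \<omega>] J[OF \<omega>] ev[of T] params by (simp add: distrib_left)
      ultimately have "\<bar>E \<omega> - \<theta> t\<bar> \<le> bias + \<bar>1 / \<phi> * S \<omega>\<bar>" by linarith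
      also have "\<bar>1 / \<phi> * S \<omega>\<bar> = 1 / \<phi> * \<bar>S \<omega>\<bar>" using pos by (simp add: abs_mult)
      finally show ?thesis using False by simp
    qed
  qed
  have [measurable]: "S \<in> borel_measurable M" using S by (simp add: has_stable_integral_def)
  have "(\<integral>\<^sup>+\<omega>. ennreal \<bar>E \<omega> - \<theta> t\<bar> \<partial>M) \<le>
      (\<integral>\<^sup>+\<omega>. ennreal (1 / \<phi>) * ennreal \<bar>S \<omega>\<bar> + ennreal bias + ennreal c2 * indicator N \<omega> \<partial>M)"
  proof (rule nn_integral_mono_AE, rule AE_mp[OF bound], intro AE_I2 impI)
    fix \<omega> assume "\<bar>E \<omega> - \<theta> t\<bar> \<le> 1 / \<phi> * \<bar>S \<omega>\<bar> + bias + c2 * indicator N \<omega>"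
    then have "ennreal \<bar>E \<omega> - \<theta> t\<bar> \<le> ennreal (1 / \<phi> * \<bar>S \<omega>\<bar> + bias + c2 * indicator N \<omega>)"
      by (rule ennreal_leI)
    also have "\<dots> = ennreal (1 / \<phi>) * ennreal \<bar>S \<omega>\<bar> + ennreal bias + ennreal c2 * indicator N \<omega>"
      using pos bias0 c2 by (simp add: ennreal_plus ennreal_mult' indicator_def flip: ennreal_mult')
    finally show "ennreal \<bar>E \<omega> - \<theta> t\<bar> \<le>
        ennreal (1 / \<phi>) * ennreal \<bar>S \<omega>\<bar> + ennreal bias + ennreal c2 * indicator N \<omega>" .
  qed
  also have "\<dots> = ennreal (1 / \<phi>) * (\<integral>\<^sup>+\<omega>. ennreal \<bar>S \<omega>\<bar> \<partial>M) + ennreal bias + ennreal c2 * emeasure M N"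
    by (simp add: nn_integral_add nn_integral_cmult emeasure_space_1)
  also have "\<dots> \<le> ennreal (1 / \<phi>) * ennreal (integral_const * R powr (1 / \<alpha>)) + ennreal bias +
      ennreal c2 * ennreal (moment_const \<alpha> * (char_const \<alpha> * T) powr (1 / \<alpha>) / (\<delta> / \<epsilon>))"
    by (intro add_mono mult_left_mono Sm Nm) auto
  also have "\<dots> = ennreal (1 / \<phi> * (integral_const * R powr (1 / \<alpha>)) + bias +
      c2 * (moment_const \<alpha> * (char_const \<alpha> * T) powr (1 / \<alpha>) / (\<delta> / \<epsilon>)))"
  proof -
    have "ennreal p * ennreal q + ennreal r + ennreal v * ennreal w = ennreal (p * q + r + v * w)"
      if "0 \<le> p" "0 \<le> q" "0 \<le> r" "0 \<le> v" "0 \<le> w" for p q r v w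
      using that by (simp add: ennreal_mult ennreal_plus)
    then show ?thesis
      using pos bias0 c2 \<delta> moment_const_nonneg[OF alpha] integral_const_nonneg by auto
  qed
  also have "1 / \<phi> * (integral_const * R powr (1 / \<alpha>)) =
      integral_const * (c1 * b) * (B - A) powr (1 / \<alpha>) * (\<epsilon> * \<phi> powr (1 / \<alpha> - 1))"
  proof -
    have "R powr (1 / \<alpha>) = (\<epsilon> * c1 * b) * (\<phi> powr (1 / \<alpha>) * (B - A) powr (1 / \<alpha>))"
      unfolding R_def using pos c1 b AB alpha by (simp add: powr_mult powr_powr)
    moreover have "\<phi> powr (1 / \<alpha>) = \<phi> * \<phi> powr (1 / \<alpha> - 1)"
      using pos by (simp add: powr_mult_base)
    ultimately show ?thesis using pos by (simp add: mult_ac)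
  qed
  also have "c2 * (moment_const \<alpha> * (char_const \<alpha> * T) powr (1 / \<alpha>) / (\<delta> / \<epsilon>)) =
      c2 * (moment_const \<alpha> * (char_const \<alpha> * T) powr (1 / \<alpha>) / \<delta>) * \<epsilon>"
    using pos by simp
  finally show ?thesis unfolding bias_def c1_def c2_def \<delta>_def .
qed

end

theorem theorem6p1:
  fixes M :: "'a measure"
    and F :: "real \<Rightarrow> 'a measure"
    and Z :: "real \<Rightarrow> 'a \<Rightarrow> real"
    and \<alpha> \<beta> T x0 L L\<gamma> \<gamma> \<rho> A B c d :: real
    and k :: nat
    and G :: "real \<Rightarrow> real"
    and X :: "real \<Rightarrow> (real \<Rightarrow> real) \<Rightarrow> real \<Rightarrow> 'a \<Rightarrow> real"
    and est :: "real \<Rightarrow> (real \<Rightarrow> real) \<Rightarrow> real \<Rightarrow> 'a \<Rightarrow> real"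
  assumes alpha: "1 < \<alpha>" "\<alpha> < 2"
    and beta: "-1 \<le> \<beta>" "\<beta> \<le> 1"
    and prob: "prob_space M"
    and filt: "right_cont_filtration M F"
    and noise: "stable_levy_process M F \<alpha> \<beta> Z"
    and params: "0 < T" "0 < x0" "0 < L" "0 < L\<gamma>"
    and smoothness: "1 \<le> k" "0 < \<gamma>" "\<gamma> < 1" "\<rho> = real k + \<gamma>"
    and A2: "A < 0" "0 < B" "G \<in> borel_measurable borel" "bounded (range G)"
      "\<And>u. u < A \<or> B < u \<Longrightarrow> G u = 0" "(LBINT u:{A..B}. G u) = 1"
    and A3: "\<And>j. 1 \<le> j \<Longrightarrow> j \<le> k \<Longrightarrow> (LBINT u. u ^ j * G u) = 0"
    and solution: "\<And>\<epsilon> \<theta>. 0 < \<epsilon> \<Longrightarrow> \<theta> \<in> hoelder_class T L k \<gamma> L\<gamma> \<Longrightarrow>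
      sde_solution M F Z T x0 \<epsilon> \<theta> (X \<epsilon> \<theta>)"
    and estimator: "\<And>\<epsilon> \<theta> t. 0 < \<epsilon> \<Longrightarrow> \<theta> \<in> hoelder_class T L k \<gamma> L\<gamma> \<Longrightarrow> t \<in> {0..T} \<Longrightarrow>
      is_estimator M F Z \<alpha> T x0 L G (\<epsilon> powr (\<alpha> / \<rho>)) \<epsilon> \<theta> (X \<epsilon> \<theta>) t (est \<epsilon> \<theta> t)"
    and interval: "0 < c" "c \<le> d" "d < T"
  shows "Limsup (at_right 0) (\<lambda>\<epsilon>.
      SUP \<theta>\<in>hoelder_class T L k \<gamma> L\<gamma>. SUP t\<in>{c..d}.
        (\<integral>\<^sup>+\<omega>. ennreal \<bar>est \<epsilon> \<theta> t \<omega> - \<theta> t\<bar> \<partial>M) * ennreal (\<epsilon> powr (- ((\<rho> + 1 - \<alpha>) / \<rho>))))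
    < \<infinity>"
proof -
  interpret stable_noise M F Z \<alpha> \<beta>
    by (intro stable_noise.intro stable_noise_axioms.intro prob alpha(1) filt noise)
  obtain b0 where b0: "\<And>u. \<bar>G u\<bar> \<le> b0"
    using A2(4) by (auto simp: bounded_iff)
  define b where "b = max b0 1"
  have b: "0 < b" "\<And>u. \<bar>G u\<bar> \<le> b"
    using b0 by (auto simp: b_def intro: max.coboundedI1)
  have \<rho>: "1 < \<rho>" using smoothness by simp
  define e where "e = (\<rho> + 1 - \<alpha>) / \<rho>"
  have e1: "e \<le> 1" using \<rho> alpha by (simp add: e_def)
  define K1 where "K1 = integral_const * (2 * exp (L * T) / x0 * b) * (B - A) powr (1 / \<alpha>)"
  define K2 where "K2 = b * L\<gamma> * max (- A) B powr (real k + \<gamma>) * (B - A)"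
  define K3 where "K3 = (L + L * b * (B - A)) *
    (moment_const \<alpha> * (char_const \<alpha> * T) powr (1 / \<alpha>) / (x0 * exp (- 3 * L * T) / 4))"
  have K0: "0 \<le> K1" "0 \<le> K2" "0 \<le> K3"
    using integral_const_nonneg moment_const_nonneg[OF alpha(1)] b params A2(1,2)
    by (simp_all add: K1_def K2_def K3_def)
  have risk: "(\<integral>\<^sup>+\<omega>. ennreal \<bar>est \<epsilon> \<theta> t \<omega> - \<theta> t\<bar> \<partial>M) * ennreal (\<epsilon> powr (- e)) \<le> ennreal (K1 + K2 + K3)"
    if \<epsilon>: "0 < \<epsilon>" "\<epsilon> < 1" "\<epsilon> powr (\<alpha> / \<rho>) * B < c" "\<epsilon> powr (\<alpha> / \<rho>) * (- A) < T - d"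
      and \<theta>: "\<theta> \<in> hoelder_class T L k \<gamma> L\<gamma>" and t: "t \<in> {c..d}" for \<epsilon> \<theta> t
  proof -
    define \<phi> where "\<phi> = \<epsilon> powr (\<alpha> / \<rho>)"
    have \<phi>: "0 < \<phi>" using \<epsilon> by (simp add: \<phi>_def)
    have tT: "t \<in> {0..T}" using t interval by auto
    have "(\<integral>\<^sup>+\<omega>. ennreal \<bar>est \<epsilon> \<theta> t \<omega> - \<theta> t\<bar> \<partial>M) \<le>
        ennreal (K1 * (\<epsilon> * \<phi> powr (1 / \<alpha> - 1)) + K2 * \<phi> powr (real k + \<gamma>) + K3 * \<epsilon>)"
      unfolding K1_def K2_def K3_def
    proof (rule estimator_error[OF params smoothness(1,2) A2(1,2,3) b A2(5,6) A3 \<epsilon>(1) \<phi> \<theta> solution[OF \<epsilon>(1) \<theta>]])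
      show "is_estimator M F Z \<alpha> T x0 L G \<phi> \<epsilon> \<theta> (X \<epsilon> \<theta>) t (est \<epsilon> \<theta> t)"
        unfolding \<phi>_def by (rule estimator[OF \<epsilon>(1) \<theta> tT])
    qed (use \<epsilon> t in \<open>auto simp: \<phi>_def\<close>)
    also have "\<dots> \<le> ennreal ((K1 + K2 + K3) * \<epsilon> powr e)"
    proof (rule ennreal_leI)
      have "\<epsilon> * \<phi> powr (1 / \<alpha> - 1) = \<epsilon> powr (1 + \<alpha> / \<rho> * (1 / \<alpha> - 1))"
        using \<epsilon> by (simp add: \<phi>_def powr_powr powr_mult_base)
      also have "1 + \<alpha> / \<rho> * (1 / \<alpha> - 1) = e"
        using \<rho> alpha by (simp add: e_def field_simps)
      finally have 1: "\<epsilon> * \<phi> powr (1 / \<alpha> - 1) = \<epsilon> powr e" .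
      have "\<phi> powr (real k + \<gamma>) = \<epsilon> powr \<alpha>"
        using \<rho> unfolding \<phi>_def powr_powr smoothness(4)[symmetric] by simp
      also have "\<dots> \<le> \<epsilon> powr e" using \<epsilon> e1 alpha by (intro powr_mono') auto
      finally have 2: "\<phi> powr (real k + \<gamma>) \<le> \<epsilon> powr e" .
      have "\<epsilon> powr 1 \<le> \<epsilon> powr e" using \<epsilon> e1 by (intro powr_mono') auto
      then have 3: "\<epsilon> \<le> \<epsilon> powr e" using \<epsilon> by simp
      show "K1 * (\<epsilon> * \<phi> powr (1 / \<alpha> - 1)) + K2 * \<phi> powr (real k + \<gamma>) + K3 * \<epsilon> \<le>
          (K1 + K2 + K3) * \<epsilon> powr e"
        unfolding 1 distrib_right using K0 2 3 by (intro add_mono mult_left_mono) auto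
    qed
    finally have "(\<integral>\<^sup>+\<omega>. ennreal \<bar>est \<epsilon> \<theta> t \<omega> - \<theta> t\<bar> \<partial>M) * ennreal (\<epsilon> powr (- e)) \<le>
        ennreal ((K1 + K2 + K3) * \<epsilon> powr e) * ennreal (\<epsilon> powr (- e))"
      by (rule mult_right_mono) simp
    also have "\<dots> = ennreal ((K1 + K2 + K3) * (\<epsilon> powr e * \<epsilon> powr (- e)))"
      using K0 by (simp add: ennreal_mult'[symmetric] ennreal_mult''[symmetric] mult.assoc)
    also have "\<epsilon> powr e * \<epsilon> powr (- e) = 1" using \<epsilon> by (simp flip: powr_add)
    finally show ?thesis by simp
  qed
  have lim: "((\<lambda>\<epsilon>. \<epsilon> powr (\<alpha> / \<rho>)) \<longlongrightarrow> 0) (at_right 0)"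
    using alpha \<rho> by (intro tendsto_zero_powrI[OF tendsto_ident_at tendsto_const])
      (auto simp: eventually_at_right_less intro: eventually_mono[OF eventually_at_right_less])
  have "\<forall>\<^sub>F \<epsilon> in at_right 0. \<epsilon> powr (\<alpha> / \<rho>) * B < c"
    using tendsto_mult_left_zero[OF lim, of B] interval(1) by (rule order_tendstoD(2))
  moreover have "\<forall>\<^sub>F \<epsilon> in at_right 0. \<epsilon> powr (\<alpha> / \<rho>) * (- A) < T - d"
    using tendsto_mult_left_zero[OF lim, of "- A"] by (rule order_tendstoD(2)) (use interval in simp)
  moreover have "\<forall>\<^sub>F \<epsilon> in at_right 0. \<epsilon> \<in> {0 <..< 1::real}"
    by (rule eventually_at_right_real) simp
  ultimately have "\<forall>\<^sub>F \<epsilon> in at_right 0. (SUP \<theta>\<in>hoelder_class T L k \<gamma> L\<gamma>. SUP t\<in>{c..d}.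
      (\<integral>\<^sup>+\<omega>. ennreal \<bar>est \<epsilon> \<theta> t \<omega> - \<theta> t\<bar> \<partial>M) * ennreal (\<epsilon> powr (- ((\<rho> + 1 - \<alpha>) / \<rho>))))
      \<le> ennreal (K1 + K2 + K3)"
  proof eventually_elim
    case (elim \<epsilon>)
    then show ?case by (intro SUP_least risk[unfolded e_def]) auto
  qed
  then show ?thesis
    by (rule le_less_trans[OF Limsup_bounded]) simp
qed

end
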